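(* Let $r$ be an odd prime, let $d\ge2$ be even, and let $N=(r-2)(d+2)+2$. Suppose further that $k$ is an integer with $d(r-2)\le rk<d(r-1)$. If $f:\Delta_N\to\mathbb{R}^d$ is a Fourier generic continuous map, then there exist $x_1\in\sigma_1,\dots,x_r\in\sigma_r$ from pairwise disjoint faces $\sigma_1,\dots,\sigma_r$ of $\Delta_N$ with $\dim\sigma_i\le k$ for all $1\le i\le r$ such that $f(x_1),\dots,f(x_r)$ are the vertices of a regular $r$-gon.
   Context: $\Delta_n$ is the $n$-simplex. A coordinate plane (line) of $\mathbb{R}^D$ is the span of two distinct (one) standard basis vectors. A regular $r$-gon in $\mathbb{R}^d$ is a non-degenerate planar regular $r$-gon. Points of a simplex have pairwise disjoint support if they lie in pairwise disjoint faces. **Fourier genericity.** Let $G=\mathbb{Z}_{q_1}\oplus\cdots\oplus\mathbb{Z}_{q_l}$ ($q_j\ge2$), with characters $\chi_h(g)=\prod_{j=1}^l\zeta_{q_j}^{h_jg_j}$, $\zeta_q=e^{2\pi i/q}$, for $g,h\in G$. For a map $F=(F_1,\dots,F_{a+b}):\Delta_n\to\mathbb{C}^a\oplus\mathbb{R}^{b}$ and points $\{x_g\}_{g\in G}\subset\Delta_n$, the Fourier coefficients are $c_{i,h}=\frac1{|G|}\sum_{g\in G}F_i(x_g)\chi_h(g)^{-1}$. An admissible choice is a family $S_i\subseteq G\setminus\{0\}$, $1\le i\le a+b$, such that for each $i>a$, writing $T_i=\{h\in S_i: h\text{ has order }2\}$, one has $-h\notin S_i$ whenever $h\in S_i\setminus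 T_i$; put $m=\sum_{i=1}^{a+b}|S_i|$ and $m'=\sum_{i=a+1}^{a+b}|T_i|$. A map $f:\Delta_M\to\mathbb{R}^D$ is Fourier generic if for every such group $G$, every decomposition $\mathbb{R}^D=\bigoplus_{i=1}^aU_i\oplus\bigoplus_{j=1}^{b}L_j$ ($D=2a+b$, $a,b\ge0$, $a+b\ge1$) into pairwise orthogonal coordinate planes $U_i$ and coordinate lines $L_j$, with $\sigma:\mathbb{R}^D\to\mathbb{C}^a\oplus\mathbb{R}^{b}$ a coordinate permutation sending $U_i$ to the $i$-th complex coordinate plane and $L_j$ to the $j$-th real coordinate line, every admissible choice of the $S_i$, and every face $\Delta_n$ of $\Delta_M$ with $n<2m-m'+|G|-1$, there is no $\{x_g\}_{g\in G}\subset\Delta_n$ with pairwise disjoint support for which all Fourier coefficients $c_{i,h}$ of $(\sigma\circ f)|_{\Delta_n}$ with $h\in S_i$, $1\le i\le a+b$, vanish. *)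

theory Defs
  imports
    "HOL-Analysis.Analysis"
    "HOL-Algebra.Multiplicative_Group"
    "HOL-Algebra.Product_Groups"
    "HOL-Computational_Algebra.Primes"
begin

definition regular_polygon_vertices :: "nat \<Rightarrow> 'a::euclidean_space set \<Rightarrow> bool" where
  "regular_polygon_vertices r P \<longleftrightarrow>
    3 \<le> r \<and>
    (\<exists>c u v \<rho>. 0 < \<rho> \<and> norm u = 1 \<and> norm v = 1 \<and> orthogonal u v \<and>
      P = (\<lambda>j. c + \<rho> *\<^sub>R (cos (2 * pi * real j / real r) *\<^sub>R u + sin (2 * pi * real j / real r) *\<^sub>R v))
            ` {..<r})"

(* D is a simplex or one of its faces. *)
definition disjoint_support :: "'a::euclidean_space set \<Rightarrow> 'i set \<Rightarrow> ('i \<Rightarrow> 'a) \<Rightarrow> bool" where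
  "disjoint_support D I x \<longleftrightarrow>
    (\<exists>\<tau>. (\<forall>i\<in>I. \<tau> i face_of D \<and> x i \<in> \<tau> i) \<and> disjoint_family_on \<tau> I)"

definition cyclic_sum :: "nat \<Rightarrow> (nat \<Rightarrow> nat) \<Rightarrow> (nat \<Rightarrow> int) monoid" where
  "cyclic_sum l q = product_group {..<l} (\<lambda>j. integer_mod_group (q j))"

definition fourier_character :: "nat \<Rightarrow> (nat \<Rightarrow> nat) \<Rightarrow> (nat \<Rightarrow> int) \<Rightarrow> (nat \<Rightarrow> int) \<Rightarrow> complex" where
  "fourier_character l q h g = (\<Prod>j<l. cis (2 * pi / real (q j)) powi (h j * g j))"

definition fourier_coefficient ::
    "nat \<Rightarrow> (nat \<Rightarrow> nat) \<Rightarrow> ((nat \<Rightarrow> int) \<Rightarrow> complex) \<Rightarrow> (nat \<Rightarrow> int) \<Rightarrow> complex" where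
  "fourier_coefficient l q y h =
    1 / of_nat (card (carrier (cyclic_sum l q))) *
      (\<Sum>g\<in>carrier (cyclic_sum l q). y g * inverse (fourier_character l q h g))"

definition coordinate_plane :: "(real ^ 'd) set \<Rightarrow> bool" where
  "coordinate_plane U \<longleftrightarrow> (\<exists>p s. p \<noteq> s \<and> U = span {axis p 1, axis s 1})"

definition coordinate_line :: "(real ^ 'd) set \<Rightarrow> bool" where
  "coordinate_line L \<longleftrightarrow> (\<exists>p. L = span {axis p 1})"

definition coordinate_decomposition ::
    "nat \<Rightarrow> nat \<Rightarrow> (nat \<Rightarrow> (real ^ 'd) set) \<Rightarrow> (nat \<Rightarrow> (real ^ 'd) set) \<Rightarrow> bool" where
  "coordinate_decomposition a b U L \<longleftrightarrow>
    CARD('d) = 2 * a + b \<and> 1 \<le> a + b \<and>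
    (\<forall>i<a. coordinate_plane (U i)) \<and> (\<forall>j<b. coordinate_line (L j)) \<and>
    (\<forall>i<a. \<forall>i'<a. i \<noteq> i' \<longrightarrow> (\<forall>u\<in>U i. \<forall>v\<in>U i'. orthogonal u v)) \<and>
    (\<forall>j<b. \<forall>j'<b. j \<noteq> j' \<longrightarrow> (\<forall>u\<in>L j. \<forall>v\<in>L j'. orthogonal u v)) \<and>
    (\<forall>i<a. \<forall>j<b. \<forall>u\<in>U i. \<forall>v\<in>L j. orthogonal u v) \<and>
    span ((\<Union>i<a. U i) \<union> (\<Union>j<b. L j)) = UNIV"

(* The space C^a + R^b. Since a and b are bound inside a formula, its elements are
   sequences of complex numbers: entries 0..a-1 are arbitrary, entries a..a+b-1 are
   real, and all further entries vanish. *)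
definition complex_real_space :: "nat \<Rightarrow> nat \<Rightarrow> (nat \<Rightarrow> complex) set" where
  "complex_real_space a b = {w. (\<forall>i\<in>{a..<a+b}. w i \<in> \<real>) \<and> (\<forall>i\<ge>a+b. w i = 0)}"

definition coordinate_axis :: "nat \<Rightarrow> nat \<Rightarrow> nat \<Rightarrow> (nat \<Rightarrow> complex) set" where
  "coordinate_axis a b i = {w \<in> complex_real_space a b. \<forall>k. k \<noteq> i \<longrightarrow> w k = 0}"

(* The real coordinates of C^a + R^b, in order, are
   Re w_0, Im w_0, ..., Re w_(a-1), Im w_(a-1), w_a, ..., w_(a+b-1),
   so that w_i with i \<ge> a is the real coordinate with index 2a + (i - a) = a + i. *)
definition coordinate_permutation :: "nat \<Rightarrow> nat \<Rightarrow> (real ^ 'd \<Rightarrow> nat \<Rightarrow> complex) \<Rightarrow> bool" where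
  "coordinate_permutation a b \<sigma> \<longleftrightarrow>
    (\<exists>p. bij_betw p {..<2 * a + b} (UNIV :: 'd set) \<and>
      (\<forall>v i. \<sigma> v i =
        (if i < a then Complex (v $ p (2 * i)) (v $ p (2 * i + 1))
         else if i < a + b then complex_of_real (v $ p (a + i))
         else 0)))"

definition order_two :: "('g, 'm) monoid_scheme \<Rightarrow> 'g set \<Rightarrow> 'g set" where
  "order_two G S = {h \<in> S. group.ord G h = 2}"

definition admissible :: "('g, 'm) monoid_scheme \<Rightarrow> nat \<Rightarrow> nat \<Rightarrow> (nat \<Rightarrow> 'g set) \<Rightarrow> bool" where
  "admissible G a b S \<longleftrightarrow>
    (\<forall>i<a+b. S i \<subseteq> carrier G - {\<one>\<^bsub>G\<^esub>}) \<and>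
    (\<forall>i\<in>{a..<a+b}. \<forall>h\<in>S i - order_two G (S i). inv\<^bsub>G\<^esub> h \<notin> S i)"

(* The dimensions in the inequality are integers, as aff_dim is. *)
definition fourier_generic :: "'a::euclidean_space set \<Rightarrow> ('a \<Rightarrow> real ^ 'd) \<Rightarrow> bool" where
  "fourier_generic \<Delta> f \<longleftrightarrow>
    (\<forall>l q a b U L \<sigma> S T.
      1 \<le> l \<and> (\<forall>j<l. 2 \<le> q j) \<and>
      coordinate_decomposition a b U L \<and>
      coordinate_permutation a b \<sigma> \<and>
      (\<forall>i<a. \<sigma> ` U i = coordinate_axis a b i) \<and>
      (\<forall>j<b. \<sigma> ` L j = coordinate_axis a b (a + j)) \<and>
      admissible (cyclic_sum l q) a b S \<and>
      T face_of \<Delta> \<and>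
      aff_dim T < 2 * int (\<Sum>i<a+b. card (S i))
                  - int (\<Sum>i\<in>{a..<a+b}. card (order_two (cyclic_sum l q) (S i)))
                  + int (card (carrier (cyclic_sum l q))) - 1
      \<longrightarrow>
      \<not> (\<exists>x. (\<forall>g\<in>carrier (cyclic_sum l q). x g \<in> T) \<and>
             disjoint_support T (carrier (cyclic_sum l q)) x \<and>
             (\<forall>i<a+b. \<forall>h\<in>S i. fourier_coefficient l q (\<lambda>g. \<sigma> (f (x g)) i) h = 0)))"

end

theory Submission
  imports Defs "HOL-Number_Theory.Cong"
begin

text \<open>
  Points of the deleted join of \<open>r\<close> copies of \<open>\<Delta>\<close> are tuples of weights \<open>t\<^sub>g\<close> and points \<open>x\<^sub>g\<close> in
  pairwise disjoint faces. One asks that the Fourier coefficients of \<open>g \<mapsto> t\<^sub>g f(x\<^sub>g)\<close> vanish except those at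
  \<open>0\<close> and \<open>1\<close>, and that \<open>g \<mapsto> t\<^sub>g (1 + \<i> dist(x\<^sub>g, skeleton))\<close> be constant. These are \<open>N/2\<close> complex
  conditions, equivariant for nontrivial characters of \<open>\<int>/r\<close>; raising each to a suitable power turns every
  character into the standard one, and a Borsuk-Ulam theorem for \<open>\<int>/r\<close> gives a solution. Constancy forces
  \<open>t\<^sub>g = 1/r\<close> and, by counting vertices, puts all \<open>x\<^sub>g\<close> in the \<open>k\<close>-skeleton. Then
  \<open>f(x\<^sub>g) = A + B \<zeta>\<^sup>g\<close> with vectors \<open>A\<close>, \<open>B\<close>, which is a regular polygon unless \<open>B = 0\<close>; and \<open>B = 0\<close>
  contradicts Fourier genericity on the face spanned by the supports.

  The Borsuk-Ulam theorem is obtained from a Tucker lemma: subdivide a sequence of chains generating a free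
  resolution of \<open>\<int>/p\<close> inside the join, label vertices by the sector of a large coordinate, and evaluate
  explicit cocycles, which are \<open>1\<close> modulo \<open>p\<close> by the resolution and \<open>0\<close> by lack of room for labels.
\<close>

text \<open>With d = 2a the conditions number a (r - 2) + (r - 1), and twice this is exactly N, so
  the Borsuk-Ulam count leaves no slack. That is why the coefficient at 1 is left free: killing it
  too would cost d further dimensions. The degenerate case must then be excluded by genericity.
  Weights and distances are two real functions, each costing r - 1 real dimensions to make constant;
  joined into one complex function they fit the remaining r - 1 complex conditions.

  The two bounds on k act at opposite ends. The lower one makes the vertices too few for every
  support to have dimension above k; the upper one keeps the face spanned by the supports below the
  dimension allowed in the definition of Fourier genericity.

  Homology enters only through the relations of the resolution. A chain is stored as the functional
  it defines on cochains, so a cone is a substitution in the cochain, subdivision is composition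
  with its transpose, and no chain groups are built.\<close>

section \<open>Cochains and subdivision\<close>

text \<open>
  Cochains are integer functions on lists of vertices. The complex is augmented: a list of length \<open>j\<close> is a
  simplex of dimension \<open>j - 1\<close>, and the empty list is the empty simplex.
\<close>

fun cobd :: "('x list \<Rightarrow> int) \<Rightarrow> 'x list \<Rightarrow> int" where
  "cobd w [] = 0"
| "cobd w (x # xs) = w xs - cobd (\<lambda>ys. w (x # ys)) xs"

lemma cobd_cong_mod:
  assumes "\<And>ys. length vs = Suc (length ys) \<Longrightarrow> set ys \<subseteq> set vs \<Longrightarrow> [w ys = w' ys] (mod m)"
  shows "[cobd w vs = cobd w' vs] (mod m)"
  using assms
proof (induction vs arbitrary: w w')
  case (Cons x xs)
  have "[cobd (\<lambda>ys. w (x # ys)) xs = cobd (\<lambda>ys. w' (x # ys)) xs] (mod m)"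
    by (rule Cons.IH) (rule Cons.prems; force)
  moreover have "[w xs = w' xs] (mod m)" by (rule Cons.prems) auto
  ultimately show ?case by (simp add: cong_diff)
qed simp

lemma cobd_cong:
  assumes "\<And>ys. length vs = Suc (length ys) \<Longrightarrow> set ys \<subseteq> set vs \<Longrightarrow> w ys = w' ys"
  shows "cobd w vs = cobd w' vs"
  using cobd_cong_mod[of vs w w' 0] assms by simp

text \<open>Tells the function package that \<open>cobd\<close> evaluates its argument only on
  shorter lists, which is what makes the nested recursion of \<open>sd\<close> terminate.\<close>

lemma cobd_fundef_cong [fundef_cong]:
  assumes "vs = vs'" "\<And>ys. length ys < length vs' \<Longrightarrow> w ys = w' ys"
  shows "cobd w vs = cobd w' vs'"
  unfolding assms(1) by (rule cobd_cong) (simp add: assms(2))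

lemma cobd_diff: "cobd (\<lambda>vs. w vs - w' vs) vs = cobd w vs - cobd w' vs"
  by (induction vs arbitrary: w w') auto

lemma cobd_mult: "cobd (\<lambda>vs. c * w vs) vs = c * cobd w vs"
  by (induction vs arbitrary: w) (auto simp: right_diff_distrib)

lemma cobd_zero: "cobd (\<lambda>vs. 0) vs = 0"
  by (induction vs) auto

lemma cobd_sum: "finite I \<Longrightarrow> cobd (\<lambda>vs. \<Sum>i\<in>I. w i vs) vs = (\<Sum>i\<in>I. cobd (w i) vs)"
  by (induction vs arbitrary: w) (auto simp: sum_subtractf)

lemma cobd_map: "cobd (\<lambda>ys. w (map t ys)) vs = cobd w (map t vs)"
  by (induction vs arbitrary: w) auto

lemma cobd_cobd: "cobd (cobd w) vs = 0"
proof (induction vs arbitrary: w)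
  case (Cons x xs)
  have "cobd (\<lambda>ys. cobd w (x # ys)) xs = cobd w xs"
    using Cons.IH[of "\<lambda>ys. w (x # ys)"] by (simp add: cobd_diff)
  then show ?case by simp
qed simp

text \<open>
  The transpose of the subdivision that cones off the subdivided boundary of a simplex \<open>vs\<close> from a new vertex
  \<open>\<beta> vs\<close>. Both barycentric subdivision and relabelling are of this form.
\<close>

function sd :: "('x list \<Rightarrow> 'y) \<Rightarrow> ('y list \<Rightarrow> int) \<Rightarrow> 'x list \<Rightarrow> int" where
  "sd \<beta> w vs = (if vs = [] then w [] else cobd (\<lambda>us. sd \<beta> (\<lambda>ys. w (\<beta> vs # ys)) us) vs)"
  by pat_completeness auto
termination by (relation "Wellfounded.measure (\<lambda>(\<beta>, w, vs). length vs)") auto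

declare sd.simps [simp del]

lemma sd_Nil [simp]: "sd \<beta> w [] = w []"
  by (simp add: sd.simps)

lemma sd_nonempty: "vs \<noteq> [] \<Longrightarrow> sd \<beta> w vs = cobd (sd \<beta> (\<lambda>ys. w (\<beta> vs # ys))) vs"
  by (subst sd.simps) simp

text \<open>Allowing every sublist of vertices instead of the facets only enlarges the relation, which is harmless.\<close>

inductive sd_simplex :: "('x list \<Rightarrow> 'y) \<Rightarrow> 'x list \<Rightarrow> 'y list \<Rightarrow> bool" for \<beta> where
  Nil: "sd_simplex \<beta> [] []"
| Cons: "sd_simplex \<beta> us ys \<Longrightarrow> length vs = Suc (length us) \<Longrightarrow> set us \<subseteq> set vs \<Longrightarrow>
    sd_simplex \<beta> vs (\<beta> vs # ys)"

lemma sd_simplex_length: "sd_simplex \<beta> vs ys \<Longrightarrow> length ys = length vs"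
  by (induction rule: sd_simplex.induct) auto

lemma sd_cong_mod:
  assumes "\<And>ys. sd_simplex \<beta> vs ys \<Longrightarrow> [w ys = w' ys] (mod m)"
  shows "[sd \<beta> w vs = sd \<beta> w' vs] (mod m)"
  using assms
proof (induction "length vs" arbitrary: vs w w')
  case 0
  then show ?case by (simp add: sd_simplex.Nil)
next
  case (Suc n)
  then have "vs \<noteq> []" by auto
  then show ?case
    unfolding sd_nonempty[OF \<open>vs \<noteq> []\<close>]
    by (intro cobd_cong_mod Suc(1) Suc(3) sd_simplex.Cons) (use Suc(2) in auto)
qed

lemma sd_diff: "sd \<beta> (\<lambda>vs. w vs - w' vs) vs = sd \<beta> w vs - sd \<beta> w' vs"
proof (induction "length vs" arbitrary: vs w w')
  case (Suc n)
  then have ne: "vs \<noteq> []" by auto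
  show ?case
    unfolding sd_nonempty[OF ne] cobd_diff[symmetric]
    by (rule cobd_cong) (use Suc in auto)
qed simp

lemma sd_sum: "finite I \<Longrightarrow> sd \<beta> (\<lambda>vs. \<Sum>i\<in>I. w i vs) vs = (\<Sum>i\<in>I. sd \<beta> (w i) vs)"
proof (induction "length vs" arbitrary: vs w)
  case (Suc n)
  then have ne: "vs \<noteq> []" by auto
  show ?case
    unfolding sd_nonempty[OF ne] cobd_sum[OF Suc(3), symmetric]
    by (rule cobd_cong) (use Suc in auto)
qed simp

text \<open>Subdivision is a chain map. The boundary of a cone is its base minus the cone over the
  boundary of the base; here the base is a subdivided boundary, so by induction the second term is a
  coboundary of a coboundary.\<close>

lemma sd_cobd: "sd \<beta> (cobd w) vs = cobd (sd \<beta> w) vs"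
proof (induction "length vs" arbitrary: vs w)
  case (Suc n)
  then have ne: "vs \<noteq> []" by auto
  let ?wb = "\<lambda>ys. w (\<beta> vs # ys)"
  have "sd \<beta> (cobd w) vs = cobd (\<lambda>us. sd \<beta> w us - sd \<beta> (cobd ?wb) us) vs"
    unfolding sd_nonempty[OF ne] by (simp add: sd_diff[abs_def])
  also have "\<dots> = cobd (\<lambda>us. sd \<beta> w us - cobd (sd \<beta> ?wb) us) vs"
    by (rule cobd_cong) (use Suc in auto)
  also have "\<dots> = cobd (sd \<beta> w) vs"
    by (simp add: cobd_diff cobd_cobd)
  finally show ?case .
qed simp

lemma sd_map:
  assumes "\<And>us. us \<noteq> [] \<Longrightarrow> set us \<subseteq> set vs \<Longrightarrow> \<beta> (map t us) = t' (\<beta> us)"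
  shows "sd \<beta> (\<lambda>ys. w (map t' ys)) vs = sd \<beta> w (map t vs)"
  using assms
proof (induction "length vs" arbitrary: vs w)
  case (Suc n)
  then have ne: "vs \<noteq> []" by auto
  have "sd \<beta> (\<lambda>ys. w (map t' ys)) vs
      = cobd (sd \<beta> (\<lambda>ys. (\<lambda>zs. w (\<beta> (map t vs) # zs)) (map t' ys))) vs"
    unfolding sd_nonempty[OF ne] using Suc(3)[OF ne] by simp
  also have "\<dots> = cobd (\<lambda>us. sd \<beta> (\<lambda>zs. w (\<beta> (map t vs) # zs)) (map t us)) vs"
    by (rule cobd_cong, rule Suc(1)) (use Suc(2,3) in auto)
  also have "\<dots> = sd \<beta> w (map t vs)"
    using ne by (simp add: cobd_map sd_nonempty)
  finally show ?case .
qed simp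

text \<open>
  Transposes of \<open>1 - t\<close> and of the norm \<open>1 + t + \<dots> + t\<^bsup>p - 1\<^esup>\<close>, the alternating boundary maps of the
  periodic resolution of \<open>\<int>/p\<close>. Chains are represented by their action on cochains.
\<close>

definition period_op :: "nat \<Rightarrow> ('x \<Rightarrow> 'x) \<Rightarrow> nat \<Rightarrow> ('x list \<Rightarrow> int) \<Rightarrow> 'x list \<Rightarrow> int" where
  "period_op p t j w vs =
    (if j = 0 then w vs
     else if odd j then w vs - w (map t vs)
     else (\<Sum>i<p. w (map (t ^^ i) vs)))"

lemma period_op_cobd: "period_op p t j (cobd w) vs = cobd (period_op p t j w) vs"
  by (simp add: period_op_def[abs_def] cobd_diff cobd_sum cobd_map)

lemma period_op_diff:
  "period_op p t j (\<lambda>vs. w vs - w' vs) vs = period_op p t j w vs - period_op p t j w' vs"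
  by (simp add: period_op_def sum_subtractf)

text \<open>The products of 1 - t and the norm telescope to 1 minus the p-th power of t. In degree 0
  the outer operator is the identity, and 1 - t vanishes on the empty list only, hence the second
  hypothesis.\<close>

lemma period_op_period_op:
  assumes "\<And>v. v \<in> set vs \<Longrightarrow> (t ^^ p) v = v" and "j = 0 \<Longrightarrow> vs = []"
  shows "period_op p t j (period_op p t (Suc j) w) vs = 0"
proof -
  have per: "map (t ^^ p) vs = vs" using assms(1) by (simp add: map_idI)
  have tele: "(\<Sum>i<p. w (map (t ^^ i) vs)) = (\<Sum>i<p. w (map (t ^^ Suc i) vs))"
  proof -
    have "(\<Sum>i<p. w (map (t ^^ Suc i) vs)) - (\<Sum>i<p. w (map (t ^^ i) vs))
        = w (map (t ^^ p) vs) - w (map (t ^^ 0) vs)"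
      unfolding sum_subtractf[symmetric] by (rule sum_lessThan_telescope)
    then show ?thesis using per by simp
  qed
  have 1: "map (t ^^ i) (map t vs) = map (t ^^ Suc i) vs" for i
    by (simp add: funpow_swap1)
  have 2: "map t (map (t ^^ i) vs) = map (t ^^ Suc i) vs" for i
    by simp
  show ?thesis
  proof (cases "j = 0")
    case True
    then show ?thesis using assms(2) by (simp add: period_op_def)
  next
    case False
    then show ?thesis
      unfolding period_op_def 1 2 using tele by (auto simp: sum_subtractf)
  qed
qed

text \<open>An equivariant chain map from the augmented periodic resolution, truncated at
  \<open>M\<close>, given modulo \<open>p\<close> by the images of its generators:
  \<open>C j\<close> is a chain of simplices with \<open>j\<close> vertices. The clauses say that
  the augmentation is normalized, that \<open>C j\<close> is supported on lists satisfying
  \<open>P\<close>, and that the boundary of \<open>C (Suc j)\<close> is the j-th resolution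
  operator applied to \<open>C j\<close>.\<close>

definition chain_system ::
  "nat \<Rightarrow> ('x \<Rightarrow> 'x) \<Rightarrow> nat \<Rightarrow> (nat \<Rightarrow> ('x list \<Rightarrow> int) \<Rightarrow> int) \<Rightarrow> ('x list \<Rightarrow> bool) \<Rightarrow> bool" where
  "chain_system p t M C P \<longleftrightarrow>
    (\<forall>w. C 0 w = w []) \<and>
    (\<forall>j\<le>M. \<forall>w w'. (\<forall>vs. length vs = j \<and> P vs \<longrightarrow> [w vs = w' vs] (mod int p)) \<longrightarrow>
      [C j w = C j w'] (mod int p)) \<and>
    (\<forall>j<M. \<forall>w. [C (Suc j) (cobd w) = C j (period_op p t j w)] (mod int p))"

lemma chain_system_cong:
  assumes "chain_system p t M C P" "j \<le> M"
    "\<And>vs. length vs = j \<Longrightarrow> P vs \<Longrightarrow> [w vs = w' vs] (mod int p)"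
  shows "[C j w = C j w'] (mod int p)"
  using assms unfolding chain_system_def by blast

lemma chain_system_cobd:
  assumes "chain_system p t M C P" "j < M"
  shows "[C (Suc j) (cobd w) = C j (period_op p t j w)] (mod int p)"
  using assms unfolding chain_system_def by blast

lemma chain_system_0: "chain_system p t M C P \<Longrightarrow> C 0 w = w []"
  unfolding chain_system_def by blast

text \<open>An equivariant chain map carries generators to generators with the same boundary
  relations. Equivariance of the subdivision comes from that of the choice of apex.\<close>

lemma sd_chain_system:
  assumes C: "chain_system p t M C P"
    and hered: "\<And>vs us. P vs \<Longrightarrow> set us \<subseteq> set vs \<Longrightarrow> P us"
    and invar: "\<And>vs. P vs \<Longrightarrow> P (map t vs)"
    and equiv: "\<And>vs. vs \<noteq> [] \<Longrightarrow> P vs \<Longrightarrow> \<beta> (map t vs) = t (\<beta> vs)"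
    and sub: "\<And>vs ys. P vs \<Longrightarrow> length vs \<le> M \<Longrightarrow> sd_simplex \<beta> vs ys \<Longrightarrow> P' ys"
  shows "chain_system p t M (\<lambda>j w. C j (sd \<beta> w)) P'"
proof -
  have inv: "P (map (t ^^ i) vs)" if "P vs" for i vs
    using invar[of "map (t ^^ k) vs" for k] that by (induction i) (auto simp: o_def)
  have eqv: "\<beta> (map (t ^^ i) vs) = (t ^^ i) (\<beta> vs)" if "vs \<noteq> []" "P vs" for i vs
    using equiv[of "map (t ^^ k) vs" for k] that inv by (induction i) (auto simp: o_def)
  have op: "sd \<beta> (period_op p t j w) vs = period_op p t j (sd \<beta> w) vs" if "P vs" for j w vs
  proof -
    have "sd \<beta> (\<lambda>ys. w (map (t ^^ i) ys)) vs = sd \<beta> w (map (t ^^ i) vs)" for i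
      by (rule sd_map) (use eqv hered that in blast)
    moreover from this[of 1] have "sd \<beta> (\<lambda>ys. w (map t ys)) vs = sd \<beta> w (map t vs)" by simp
    ultimately show ?thesis by (simp add: period_op_def[abs_def] sd_diff sd_sum)
  qed
  show ?thesis
    unfolding chain_system_def
  proof (intro conjI allI impI)
    fix w show "C 0 (sd \<beta> w) = w []" using chain_system_0[OF C] by simp
  next
    fix j and w w' :: "'a list \<Rightarrow> int"
    assume "j \<le> M" and w: "\<forall>vs. length vs = j \<and> P' vs \<longrightarrow> [w vs = w' vs] (mod int p)"
    then show "[C j (sd \<beta> w) = C j (sd \<beta> w')] (mod int p)"
      by (intro chain_system_cong[OF C] sd_cong_mod) (use w sub sd_simplex_length in force)+
  next
    fix j w assume "j < M"
    have "[C (Suc j) (cobd (sd \<beta> w)) = C j (period_op p t j (sd \<beta> w))] (mod int p)"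
      by (rule chain_system_cobd[OF C \<open>j < M\<close>])
    moreover have "[C j (period_op p t j (sd \<beta> w)) = C j (sd \<beta> (period_op p t j w))] (mod int p)"
      by (rule chain_system_cong[OF C]) (use op \<open>j < M\<close> in auto)
    moreover have "sd \<beta> (cobd w) = cobd (sd \<beta> w)" by (rule ext) (rule sd_cobd)
    ultimately show "[C (Suc j) (sd \<beta> (cobd w)) = C j (sd \<beta> (period_op p t j w))] (mod int p)"
      by (metis cong_trans)
  qed
qed

text \<open>The next chain is the cone with apex \<open>b j\<close> over the resolution operator
  applied to the current one.\<close>

fun cone_chain :: "nat \<Rightarrow> ('x \<Rightarrow> 'x) \<Rightarrow> (nat \<Rightarrow> 'x) \<Rightarrow> nat \<Rightarrow> ('x list \<Rightarrow> int) \<Rightarrow> int" where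
  "cone_chain p t b 0 w = w []"
| "cone_chain p t b (Suc j) w = cone_chain p t b j (period_op p t j (\<lambda>us. w (b j # us)))"

text \<open>\<open>\<kappa>\<close> picks one translate from each orbit, so the list lies in a
  single simplex of the join of the orbits.\<close>

definition partial_orbit_list :: "('x \<Rightarrow> 'x) \<Rightarrow> (nat \<Rightarrow> 'x) \<Rightarrow> nat \<Rightarrow> 'x list \<Rightarrow> bool" where
  "partial_orbit_list t b M vs \<longleftrightarrow> (\<exists>\<kappa>. set vs \<subseteq> (\<lambda>m. (t ^^ \<kappa> m) (b m)) ` {..<M})"

lemma partial_orbit_list_shift:
  assumes "partial_orbit_list t b M vs"
  shows "partial_orbit_list t b M (map (t ^^ i) vs)"
proof -
  obtain \<kappa> where \<kappa>: "set vs \<subseteq> (\<lambda>m. (t ^^ \<kappa> m) (b m)) ` {..<M}"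
    using assms partial_orbit_list_def by metis
  have "set (map (t ^^ i) vs) \<subseteq> (\<lambda>m. (t ^^ (i + \<kappa> m)) (b m)) ` {..<M}"
    using \<kappa> by (fastforce simp: funpow_add)
  then show ?thesis unfolding partial_orbit_list_def by (intro exI)
qed

lemma partial_orbit_list_Cons:
  assumes "partial_orbit_list t b j vs"
  shows "partial_orbit_list t b (Suc j) (b j # vs)"
proof -
  obtain \<kappa> where \<kappa>: "set vs \<subseteq> (\<lambda>m. (t ^^ \<kappa> m) (b m)) ` {..<j}"
    using assms partial_orbit_list_def by metis
  have "set (b j # vs) \<subseteq> (\<lambda>m. (t ^^ (\<kappa>(j := 0)) m) (b m)) ` {..<Suc j}"
  proof -
    have "(\<lambda>m. (t ^^ \<kappa> m) (b m)) ` {..<j} = (\<lambda>m. (t ^^ (\<kappa>(j := 0)) m) (b m)) ` {..<j}"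
      by (rule image_cong) auto
    then show ?thesis using \<kappa> by (auto simp: lessThan_Suc)
  qed
  then show ?thesis unfolding partial_orbit_list_def by (intro exI)
qed

lemma cone_chain_cong:
  assumes "\<And>vs. length vs = j \<Longrightarrow> partial_orbit_list t b j vs \<Longrightarrow> [w vs = w' vs] (mod m)"
  shows "[cone_chain p t b j w = cone_chain p t b j w'] (mod m)"
  using assms
proof (induction j arbitrary: w w')
  case 0
  then show ?case by (simp add: partial_orbit_list_def)
next
  case (Suc j)
  have eq: "[w (b j # map (t ^^ i) vs) = w' (b j # map (t ^^ i) vs)] (mod m)"
    if "length vs = j" "partial_orbit_list t b j vs" for vs i
    using that by (intro Suc.prems partial_orbit_list_Cons partial_orbit_list_shift) auto
  show ?case
    unfolding cone_chain.simps
  proof (rule Suc.IH)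
    fix vs assume vs: "length vs = j" "partial_orbit_list t b j vs"
    show "[period_op p t j (\<lambda>us. w (b j # us)) vs = period_op p t j (\<lambda>us. w' (b j # us)) vs] (mod m)"
      using eq[OF vs, of 0] eq[OF vs, of 1] eq[OF vs]
      by (auto simp: period_op_def intro!: cong_diff cong_sum)
  qed
qed

lemma cone_chain_diff:
  "cone_chain p t b j (\<lambda>vs. w vs - w' vs) = cone_chain p t b j w - cone_chain p t b j w'"
  by (induction j arbitrary: w w') (auto simp: period_op_diff[abs_def])

lemma cone_chain_zero: "cone_chain p t b j (\<lambda>vs. 0) = 0"
  using cone_chain_diff[of p t b j "\<lambda>_. 0" "\<lambda>_. 0"] by simp

lemma funpow_period:
  assumes "(t ^^ p) x = x"
  shows "(t ^^ p) ((t ^^ i) x) = (t ^^ i) x"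
  using assms by (metis add.commute comp_apply funpow_add)

text \<open>The base of each cone is a cycle, because its boundary is a product of two consecutive
  resolution operators; the boundary of the cone is therefore just the base.\<close>

lemma cone_chain_cobd:
  assumes per: "\<And>m. (t ^^ p) (b m) = b m"
  shows "cone_chain p t b (Suc j) (cobd w) = cone_chain p t b j (period_op p t j w)"
proof (induction j arbitrary: w)
  case 0
  then show ?case by (simp add: period_op_def)
next
  case (Suc j)
  let ?w = "\<lambda>us. w (b (Suc j) # us)"
  have "cone_chain p t b (Suc (Suc j)) (cobd w)
      = cone_chain p t b (Suc j) (period_op p t (Suc j) w)
        - cone_chain p t b (Suc j) (cobd (period_op p t (Suc j) ?w))"
    by (simp only: cone_chain.simps(2)[of _ _ _ "Suc j"] cobd.simps cone_chain_diff
        period_op_diff[abs_def] period_op_cobd[abs_def])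
  also have "cone_chain p t b (Suc j) (cobd (period_op p t (Suc j) ?w)) = 0"
  proof -
    have "cone_chain p t b (Suc j) (cobd (period_op p t (Suc j) ?w))
      = cone_chain p t b j (period_op p t j (period_op p t (Suc j) ?w))"
      by (rule Suc.IH)
    \<comment> \<open>Congruence modulo 0 is equality, so the congruence lemma gives an exact
      statement here.\<close>
    moreover have "[\<dots> = cone_chain p t b j (\<lambda>_. 0)] (mod 0)"
    proof (rule cone_chain_cong)
      fix vs assume "length vs = j" and "partial_orbit_list t b j vs"
      then have "period_op p t j (period_op p t (Suc j) ?w) vs = 0"
        by (intro period_op_period_op)
          (auto simp: partial_orbit_list_def funpow_period[OF per])
      then show "[period_op p t j (period_op p t (Suc j) ?w) vs = 0] (mod 0)" by simp
    qed
    ultimately show ?thesis by (simp add: cone_chain_zero)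
  qed
  finally show ?case by simp
qed

lemma partial_orbit_list_mono: "partial_orbit_list t b j vs \<Longrightarrow> j \<le> M \<Longrightarrow> partial_orbit_list t b M vs"
  unfolding partial_orbit_list_def by (meson image_mono lessThan_subset_iff subset_trans)

lemma cone_chain_system:
  assumes "\<And>m. (t ^^ p) (b m) = b m"
  shows "chain_system p t M (cone_chain p t b) (partial_orbit_list t b M)"
  unfolding chain_system_def
  by (auto simp: cone_chain_cobd[OF assms] simp del: cone_chain.simps(2)
      intro!: cone_chain_cong intro: partial_orbit_list_mono)

section \<open>A Tucker lemma for cyclic groups\<close>

text \<open>
  With \<open>u = cobd (wcoch k)\<close>, which is invariant modulo \<open>p\<close>, the norm of \<open>vcoch p k\<close> is \<open>u\<close>, and
  \<open>1 - t\<close> maps \<open>wcoch (Suc k)\<close> to the coboundary of \<open>vcoch p k\<close>: the indicator of \<open>a < b\<close> changes under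
  rotation exactly when \<open>a\<close> or \<open>b\<close> wraps around.
\<close>

primrec wcoch :: "nat \<Rightarrow> int list \<Rightarrow> int" where
  "wcoch 0 = (\<lambda>xs. - hd xs)"
| "wcoch (Suc k) = (\<lambda>xs. of_bool (hd xs < hd (tl xs)) * cobd (wcoch k) (tl xs))"

definition vcoch :: "int \<Rightarrow> nat \<Rightarrow> int list \<Rightarrow> int" where
  "vcoch p k xs = of_bool (hd xs = p - 1) * cobd (wcoch k) xs"

lemma cobd_cocycle_Cons:
  "cobd (\<lambda>ys. c * cobd w (x # ys)) zs = c * cobd w zs"
proof -
  have "cobd (\<lambda>ys. cobd w (x # ys)) zs = cobd w zs"
    using cobd_cobd[of w "x # zs"] by simp
  then show ?thesis by (simp only: cobd_mult)
qed

lemma cobd_vcoch: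
  "cobd (vcoch p k) (a # b # zs)
    = (of_bool (b = p - 1) - of_bool (a = p - 1)) * cobd (wcoch k) (b # zs)"
proof -
  have "cobd (vcoch p k) (a # b # zs) = vcoch p k (b # zs) - cobd (\<lambda>ys. vcoch p k (a # ys)) (b # zs)"
    by (rule cobd.simps(2))
  then show ?thesis by (simp only: vcoch_def list.sel cobd_cocycle_Cons left_diff_distrib)
qed

text \<open>For distinct a, b, c the factor is the indicator of their cyclic order: a coboundary of
  the linear order that no longer depends on where the cycle is cut.\<close>

lemma cobd_wcoch_Suc:
  "cobd (wcoch (Suc k)) (a # b # c # zs)
    = (of_bool (b < c) - of_bool (a < c) + of_bool (a < b)) * cobd (wcoch k) (c # zs)"
proof -
  have "cobd (wcoch (Suc k)) (a # b # c # zs)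
    = wcoch (Suc k) (b # c # zs) - (wcoch (Suc k) (a # c # zs)
        - cobd (\<lambda>ys. wcoch (Suc k) (a # b # ys)) (c # zs))"
    by (simp only: cobd.simps(2)[of _ a "b # c # zs"] cobd.simps(2)[of _ b "c # zs"])
  also have "\<dots> = of_bool (b < c) * cobd (wcoch k) (c # zs) - (of_bool (a < c) * cobd (wcoch k) (c # zs)
        - of_bool (a < b) * cobd (wcoch k) (c # zs))"
    by (simp only: wcoch.simps list.sel cobd_cocycle_Cons)
  finally show ?thesis by (simp add: algebra_simps)
qed

lemma cobd_wcoch_0: "cobd (wcoch 0) [a, b] = a - b"
  by simp

lemma length_even_cases:
  assumes "length xs = 2 * Suc k + 2"
  obtains a b c zs where "xs = a # b # c # zs" "length (c # zs) = 2 * k + 2"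
proof -
  obtain a b c zs where "xs = a # b # c # zs"
    using assms by (auto simp: numeral_eq_Suc length_Suc_conv)
  then show ?thesis using that assms by auto
qed

text \<open>The value is a product of cyclic order factors in a, b, c and a final difference a - b.
  A factor vanishes as soon as a = b or b = c, and together the factors see every adjacent
  pair.\<close>

lemma cobd_wcoch_not_distinct_adj:
  "length xs = 2 * k + 2 \<Longrightarrow> \<not> distinct_adj xs \<Longrightarrow> cobd (wcoch k) xs = 0"
proof (induction k arbitrary: xs)
  case 0
  then obtain a b where "xs = [a, b]" by (auto simp: numeral_eq_Suc length_Suc_conv)
  with 0 show ?case by (auto simp: cobd_wcoch_0 simp del: wcoch.simps)
next
  case (Suc k)
  from Suc.prems(1) obtain a b c zs where
    xs: "xs = a # b # c # zs" "length (c # zs) = 2 * k + 2" by (rule length_even_cases)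
  from Suc.prems(2) xs consider "a = b" | "b = c" | "\<not> distinct_adj (c # zs)" by auto
  then show ?case
    using Suc.IH[OF xs(2)] unfolding xs(1) cobd_wcoch_Suc by cases auto
qed

definition rotate_residue :: "int \<Rightarrow> int \<Rightarrow> int" where
  "rotate_residue p x = (x + 1) mod p"

lemma rotate_residue_eq: "x \<in> {0..<p} \<Longrightarrow> rotate_residue p x = (if x = p - 1 then 0 else x + 1)"
  by (auto simp: rotate_residue_def)

lemma cyclic_order_rotate:
  assumes "a \<in> {0..<p}" "b \<in> {0..<p}"
  shows "of_bool (a < b) - (of_bool (rotate_residue p a < rotate_residue p b) :: int)
    = of_bool (b = p - 1) - of_bool (a = p - 1)"
  using assms by (auto simp: rotate_residue_eq)

text \<open>In the cyclic order factors the wraparound terms of the three comparisons cancel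
  exactly; only the final difference a - b needs the modulus.\<close>

lemma cobd_wcoch_rotate:
  "length xs = 2 * k + 2 \<Longrightarrow> set xs \<subseteq> {0..<p} \<Longrightarrow>
    [cobd (wcoch k) (map (rotate_residue p) xs) = cobd (wcoch k) xs] (mod p)"
proof (induction k arbitrary: xs)
  case 0
  then obtain a b where "xs = [a, b]" by (auto simp: numeral_eq_Suc length_Suc_conv)
  moreover have "[rotate_residue p a - rotate_residue p b = (a + 1) - (b + 1)] (mod p)"
    unfolding rotate_residue_def by (intro cong_diff) simp_all
  ultimately show ?case by (simp add: cobd_wcoch_0 del: wcoch.simps cobd.simps)
next
  case (Suc k)
  from Suc.prems(1) obtain a b c zs where
    xs: "xs = a # b # c # zs" "length (c # zs) = 2 * k + 2" by (rule length_even_cases)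
  let ?r = "rotate_residue p"
  have in_p: "a \<in> {0..<p}" "b \<in> {0..<p}" "c \<in> {0..<p}" "set (c # zs) \<subseteq> {0..<p}"
    using Suc.prems(2) xs(1) by auto
  have eq: "of_bool (?r b < ?r c) - of_bool (?r a < ?r c) + (of_bool (?r a < ?r b) :: int)
      = of_bool (b < c) - of_bool (a < c) + of_bool (a < b)"
    using cyclic_order_rotate[of a p b] cyclic_order_rotate[of b p c] cyclic_order_rotate[of a p c]
      in_p by linarith
  have "[cobd (wcoch k) (?r c # map ?r zs) = cobd (wcoch k) (c # zs)] (mod p)"
    using Suc.IH[OF xs(2) in_p(4)] by simp
  then show ?case
    unfolding xs(1) list.map cobd_wcoch_Suc eq by (intro cong_mult) simp_all
qed

lemma funpow_rotate_residue:
  "x \<in> {0..<p} \<Longrightarrow> (rotate_residue p ^^ i) x = (x + int i) mod p"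
  by (induction i) (auto simp: rotate_residue_def mod_simps add_ac)

lemma cobd_wcoch_rotate_funpow:
  assumes "length xs = 2 * k + 2" "set xs \<subseteq> {0..<p}"
  shows "[cobd (wcoch k) (map (rotate_residue p ^^ i) xs) = cobd (wcoch k) xs] (mod p)"
proof (induction i)
  case (Suc i)
  let ?ys = "map (rotate_residue p ^^ i) xs"
  have "set ?ys \<subseteq> {0..<p}"
  proof -
    have "p > 0" if "x \<in> set xs" for x using that assms(2) by fastforce
    then show ?thesis using assms(2) funpow_rotate_residue[of _ p i] by fastforce
  qed
  then have "[cobd (wcoch k) (map (rotate_residue p) ?ys) = cobd (wcoch k) ?ys] (mod p)"
    using assms(1) by (intro cobd_wcoch_rotate) auto
  then show ?case using Suc by (auto intro: cong_trans simp: o_def)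
qed simp

text \<open>Exactly one of the p rotations brings x to p - 1. Multiplication by this marker
  therefore inverts the norm on invariant cochains.\<close>

lemma sum_rotate_marker:
  assumes "x \<in> {0..<int p}"
  shows "(\<Sum>i<p. of_bool ((rotate_residue (int p) ^^ i) x = int p - 1)) = (1 :: int)"
proof -
  have eq: "(rotate_residue (int p) ^^ i) x = int p - 1 \<longleftrightarrow> i = nat (int p - 1 - x)" if "i < p" for i
  proof -
    have x: "0 \<le> x" "x < int p" using assms by auto
    have "(x + int i) mod int p = (if x + int i < int p then x + int i else x + int i - int p)"
    proof (cases "x + int i < int p")
      case False
      then have "(x + int i) mod int p = (x + int i - int p) mod int p" by simp
      also have "\<dots> = x + int i - int p" by (rule mod_pos_pos_trivial) (use x that False in linarith)+
      finally show ?thesis using False by simp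
    qed (use x in simp)
    then show ?thesis using x that by (simp add: funpow_rotate_residue) arith
  qed
  have "(\<Sum>i<p. of_bool ((rotate_residue (int p) ^^ i) x = int p - 1))
      = (\<Sum>i<p. if i = nat (int p - 1 - x) then 1 else (0::int))"
    by (rule sum.cong) (use eq in auto)
  also have "\<dots> = 1" using assms by (auto simp: sum.delta)
  finally show ?thesis .
qed

text \<open>Linearity of \<open>C j\<close> is not among the clauses of \<open>chain_system\<close>.
  Instead, the zero cochain is its own coboundary, and the boundary relations carry its value down
  to degree 0.\<close>

lemma chain_system_zero:
  assumes "chain_system p t M C P" "j \<le> M"
  shows "[C j (\<lambda>_. 0) = 0] (mod int p)"
  using assms(2)
proof (induction j)
  case 0
  then show ?case using chain_system_0[OF assms(1)] by simp
next
  case (Suc j)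
  have "cobd (\<lambda>_. 0) = (\<lambda>_::'a list. 0)" by (rule ext) (rule cobd_zero)
  moreover have "period_op p t j (\<lambda>_. 0) = (\<lambda>_. 0)" by (rule ext) (simp add: period_op_def)
  ultimately have "[C (Suc j) (\<lambda>_. 0) = C j (\<lambda>_. 0)] (mod int p)"
    using chain_system_cobd[OF assms(1), of j "\<lambda>_. 0"] Suc.prems by simp
  with Suc show ?case by (metis Suc_leD cong_trans)
qed

text \<open>The boundary relations carry the value of the coboundary of \<open>vcoch\<close> with
  index n - 1 down, alternately through 1 - t and the norm, to the value 1 of the constant cochain 1
  in degree 0. If every simplex with 2n + 1 vertices had two adjacent equal labels, the same cochain
  would vanish on all of them.\<close>

theorem Zp_Tucker:
  fixes lab :: "'x \<Rightarrow> int"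
  assumes p: "2 \<le> p" and n: "1 \<le> n"
    and C: "chain_system p t (2 * n + 1) C P"
    and lab: "\<And>vs v. P vs \<Longrightarrow> v \<in> set vs \<Longrightarrow> lab v \<in> {0..<int p}"
    and lab_t: "\<And>vs v i. P vs \<Longrightarrow> v \<in> set vs \<Longrightarrow>
      lab ((t ^^ i) v) = (rotate_residue (int p) ^^ i) (lab v)"
  obtains vs where "P vs" "length vs = 2 * n + 1" "distinct_adj (map lab vs)"
proof (rule ccontr)
  assume none: "\<not> thesis"
  define L :: "(int list \<Rightarrow> int) \<Rightarrow> 'x list \<Rightarrow> int" where "L w vs = w (map lab vs)" for w vs
  have L_cobd: "cobd (L w) = L (cobd w)" for w
    unfolding L_def by (rule ext) (simp add: cobd_map)
  have lab_map: "map lab (map (t ^^ i) vs) = map (rotate_residue (int p) ^^ i) (map lab vs)"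
    if "P vs" for vs i using lab_t[OF that] by simp
  have lab_set: "set (map lab vs) \<subseteq> {0..<int p}" if "P vs" for vs using lab[OF that] by auto
  have odd_op: "period_op p t (2 * k + 1) (L w) vs
      = w (map lab vs) - w (map (rotate_residue (int p)) (map lab vs))" if "P vs" for k w vs
    using lab_map[OF that, of 1] by (simp add: period_op_def L_def del: map_map)
  have even_op: "period_op p t (2 * k + 2) (L w) vs
      = (\<Sum>i<p. w (map (rotate_residue (int p) ^^ i) (map lab vs)))" if "P vs" for k w vs
    using lab_map[OF that] by (simp add: period_op_def L_def del: map_map)
  have step: "[C (Suc j) (L (cobd w)) = C j w'] (mod int p)"
    if "j < 2 * n + 1" and
      "\<And>vs. length vs = j \<Longrightarrow> P vs \<Longrightarrow> [period_op p t j (L w) vs = w' vs] (mod int p)" for j w w'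
    using cong_trans[OF chain_system_cobd[OF C that(1)] chain_system_cong[OF C _ that(2)]] that(1)
    by (simp add: L_cobd)
  \<comment> \<open>On a single vertex the coboundary of 1 is the value 1 at the empty list, so this
    is the augmentation relation.\<close>
  have one: "[C 1 (\<lambda>_. 1) = 1] (mod int p)"
  proof -
    have "[C 1 (cobd (\<lambda>_. 1)) = C 0 (period_op p t 0 (\<lambda>_. 1))] (mod int p)"
      using chain_system_cobd[OF C, of 0] by simp
    moreover have "[C 1 (cobd (\<lambda>_. 1)) = C 1 (\<lambda>_. 1)] (mod int p)"
      by (rule chain_system_cong[OF C]) (auto simp: length_Suc_conv)
    ultimately show ?thesis
      using chain_system_0[OF C] by (metis cong_sym cong_trans period_op_def)
  qed
  have odd: "[C (Suc (2 * k + 2)) (L (cobd (vcoch (int p) k))) = C (2 * k + 2) (L (cobd (wcoch k)))] (mod int p)"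
  if "k < n" for k
  proof (rule step)
    fix vs assume vs: "length vs = 2 * k + 2" "P vs"
    let ?ls = "map lab vs" and ?r = "rotate_residue (int p)"
    have "hd ?ls \<in> {0..<int p}" using lab_set[OF vs(2)] vs(1) hd_in_set[of ?ls] by fastforce
    have "[(\<Sum>i<p. vcoch (int p) k (map (?r ^^ i) ?ls))
        = (\<Sum>i<p. of_bool ((?r ^^ i) (hd ?ls) = int p - 1) * cobd (wcoch k) ?ls)] (mod int p)"
    proof (rule cong_sum)
      fix i
      have "hd (map (?r ^^ i) ?ls) = (?r ^^ i) (hd ?ls)" using vs(1) by (intro hd_map) auto
      then show "[vcoch (int p) k (map (?r ^^ i) ?ls)
          = of_bool ((?r ^^ i) (hd ?ls) = int p - 1) * cobd (wcoch k) ?ls] (mod int p)"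
        unfolding vcoch_def using vs lab_set[OF vs(2)]
        by (auto intro!: cong_mult cobd_wcoch_rotate_funpow simp del: map_map)
    qed
    also have "(\<Sum>i<p. of_bool ((?r ^^ i) (hd ?ls) = int p - 1) * cobd (wcoch k) ?ls)
        = cobd (wcoch k) ?ls"
      unfolding sum_distrib_right[symmetric]
      using sum_rotate_marker[OF \<open>hd ?ls \<in> _\<close>] by simp
    finally show "[period_op p t (2 * k + 2) (L (vcoch (int p) k)) vs = L (cobd (wcoch k)) vs] (mod int p)"
      using even_op[OF vs(2)] by (simp add: L_def)
  qed (use that in simp)
  have even: "[C (2 * k + 2) (L (cobd (wcoch k))) = 1] (mod int p)" if "k < n" for k
    using that
  proof (induction k)
    case 0
    have "[C (Suc 1) (L (cobd (wcoch 0))) = C 1 (\<lambda>_. 1)] (mod int p)"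
    proof (rule step)
      fix vs assume vs: "length vs = 1" "P vs"
      then obtain v where v: "vs = [v]" by (auto simp: length_Suc_conv)
      \<comment> \<open>\<open>wcoch 0\<close> is minus the label, so 1 - t turns it into the
        increment of the label under one rotation, which is 1 modulo \<open>p\<close>.\<close>
      have "[rotate_residue (int p) (lab v) - lab v = (lab v + 1) - lab v] (mod int p)"
        unfolding rotate_residue_def by (intro cong_diff) simp_all
      then show "[period_op p t 1 (L (wcoch 0)) vs = 1] (mod int p)"
        using odd_op[OF vs(2), of 0 "wcoch 0"] v by simp
    qed (use n in simp)
    from cong_trans[OF this one] show ?case by (simp del: wcoch.simps cobd.simps add: numeral_2_eq_2)
  next
    case (Suc k)
    have "[C (Suc (2 * k + 3)) (L (cobd (wcoch (Suc k)))) = C (2 * k + 3) (L (cobd (vcoch (int p) k)))] (mod int p)"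
    proof (rule step)
      fix vs assume vs: "length vs = 2 * k + 3" "P vs"
      then obtain a b zs where ls: "map lab vs = a # b # zs" "length (b # zs) = 2 * k + 2"
        by (auto simp: numeral_eq_Suc length_Suc_conv)
      let ?r = "rotate_residue (int p)"
      have in_p: "a \<in> {0..<int p}" "b \<in> {0..<int p}" "set (b # zs) \<subseteq> {0..<int p}"
        using lab_set[OF vs(2)] ls(1) by auto
      have "period_op p t (2 * Suc k + 1) (L (wcoch (Suc k))) vs
          = of_bool (a < b) * cobd (wcoch k) (b # zs)
            - of_bool (?r a < ?r b) * cobd (wcoch k) (map ?r (b # zs))"
        unfolding odd_op[OF vs(2)] ls(1) by simp
      also have "[\<dots> = of_bool (a < b) * cobd (wcoch k) (b # zs)
            - of_bool (?r a < ?r b) * cobd (wcoch k) (b # zs)] (mod int p)"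
        by (intro cong_diff cong_mult cobd_wcoch_rotate cong_refl ls(2) in_p(3))
      also have "of_bool (a < b) * cobd (wcoch k) (b # zs)
            - of_bool (?r a < ?r b) * cobd (wcoch k) (b # zs)
          = cobd (vcoch (int p) k) (map lab vs)"
        unfolding ls(1) cobd_vcoch cyclic_order_rotate[OF in_p(1,2), symmetric] left_diff_distrib ..
      finally show "[period_op p t (2 * k + 3) (L (wcoch (Suc k))) vs
          = L (cobd (vcoch (int p) k)) vs] (mod int p)"
        by (simp add: L_def[of "cobd (vcoch (int p) k)"] numeral_3_eq_3 del: wcoch.simps)
    qed (use Suc.prems in simp)
    then show ?case
      using Suc odd[of k] by (auto simp: numeral_3_eq_3 intro: cong_trans simp del: wcoch.simps)
  qed
  obtain k where k: "n = Suc k" using n by (cases n) auto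
  have "[C (2 * n + 1) (L (cobd (vcoch (int p) k))) = 1] (mod int p)"
    using odd[of k] even[of k] k by (auto intro: cong_trans)
  moreover have "[C (2 * n + 1) (L (cobd (vcoch (int p) k))) = C (2 * n + 1) (\<lambda>_. 0)] (mod int p)"
  proof (rule chain_system_cong[OF C])
    fix vs assume vs: "length vs = 2 * n + 1" "P vs"
    then have nd: "\<not> distinct_adj (map lab vs)" using none that by blast
    obtain a b zs where ls: "map lab vs = a # b # zs" "length (b # zs) = 2 * k + 2"
      using vs k by (auto simp: numeral_eq_Suc length_Suc_conv)
    from nd ls consider "a = b" | "\<not> distinct_adj (b # zs)" by auto
    then have "cobd (vcoch (int p) k) (map lab vs) = 0"
      unfolding ls(1) cobd_vcoch using cobd_wcoch_not_distinct_adj[OF ls(2)] by cases auto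
    then show "[L (cobd (vcoch (int p) k)) vs = 0] (mod int p)" by (simp add: L_def)
  qed simp
  ultimately have "[1 = (0::int)] (mod int p)"
    using chain_system_zero[OF C, of "2 * n + 1"] by (metis cong_sym cong_trans order_refl)
  then show False using p by (simp add: cong_def)
qed

section \<open>Barycentric subdivision of joins\<close>

definition bary :: "('i \<Rightarrow> 'v::real_vector) list \<Rightarrow> 'i \<Rightarrow> 'v" where
  "bary us g = (1 / real (length us)) *\<^sub>R (\<Sum>i<length us. (us ! i) g)"

lemma sd_simplex_closed:
  assumes "sd_simplex \<beta> vs ys"
    and "\<And>us. us \<noteq> [] \<Longrightarrow> set us \<subseteq> Q \<Longrightarrow> \<beta> us \<in> R"
    and "set vs \<subseteq> Q"
  shows "set ys \<subseteq> R"
  using assms(1,3)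
proof (induction rule: sd_simplex.induct)
  case (Cons us ys vs)
  moreover have "vs \<noteq> []" using Cons.hyps(2) by auto
  ultimately show ?case using assms(2)[of vs] by auto
qed simp

lemma bary_diff:
  assumes "us \<noteq> []"
  shows "bary us g - q = (1 / real (length us)) *\<^sub>R (\<Sum>i<length us. (us ! i) g - q)"
proof -
  have "(1 / real (length us)) *\<^sub>R (\<Sum>i<length us. q) = q"
    using assms by (simp only: sum_constant_scaleR) simp
  then show ?thesis by (simp add: bary_def sum_subtractf scaleR_right_diff_distrib)
qed

lemma norm_bary_diff_le:
  fixes q :: "'v::real_normed_vector"
  assumes "us \<noteq> []" "\<And>u. u \<in> set us \<Longrightarrow> norm (u g - q) \<le> c"
  shows "norm (bary us g - q) \<le> c"
proof -
  have "norm (\<Sum>i<length us. (us ! i) g - q) \<le> real (card {..<length us}) * c"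
    by (rule order_trans[OF norm_sum sum_bounded_above]) (simp add: assms(2))
  then show ?thesis using assms(1) by (simp add: bary_diff field_simps)
qed

text \<open>In the average of the differences to v the term of v itself is zero. At most L - 1 of L
  terms remain, and (L - 1) / L increases with L.\<close>

lemma norm_bary_diff_vertex_le:
  fixes v :: "'i \<Rightarrow> 'v::real_normed_vector"
  assumes "v \<in> set us" "length us \<le> Suc M"
    "\<And>u. u \<in> set us \<Longrightarrow> norm (u g - v g) \<le> D" "0 \<le> D"
  shows "norm (v g - bary us g) \<le> real M / real (Suc M) * D"
proof -
  let ?L = "real (length us)"
  obtain k where k: "k < length us" "us ! k = v" using assms(1) by (meson in_set_conv_nth)
  have L: "?L \<ge> 1" "us \<noteq> []" using k by auto
  have "(\<Sum>i<length us. (us ! i) g - v g) = (\<Sum>i\<in>{..<length us} - {k}. (us ! i) g - v g)"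
    using k by (intro sum.mono_neutral_right) auto
  also have "norm \<dots> \<le> real (card ({..<length us} - {k})) * D"
    by (rule order_trans[OF norm_sum sum_bounded_above]) (simp add: assms(3))
  also have "\<dots> = (?L - 1) * D" using k(1) by (simp add: of_nat_diff)
  finally have "norm (bary us g - v g) \<le> (1 / ?L) * ((?L - 1) * D)"
    using L by (simp add: bary_diff divide_right_mono)
  also have "\<dots> = ((?L - 1) / ?L) * D" by simp
  also have "\<dots> \<le> real M / real (Suc M) * D"
  proof (rule mult_right_mono)
    show "(?L - 1) / ?L \<le> real M / real (Suc M)"
      using L assms(2) by (simp add: field_simps)
  qed (fact assms(4))
  finally show ?thesis by (simp add: norm_minus_commute)
qed

text \<open>Either both vertices belong to the subdivision of a smaller list, or one is the apex
  \<open>bary vs\<close> and the other an average of vertices of vs, all of which lie in a ball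
  around the apex.\<close>

lemma sd_bary_mesh:
  fixes vs :: "('i \<Rightarrow> 'v::real_normed_vector) list"
  assumes "sd_simplex bary vs ys" "length vs \<le> Suc M" "0 \<le> D"
    "\<And>u v. u \<in> set vs \<Longrightarrow> v \<in> set vs \<Longrightarrow> norm (u g - v g) \<le> D"
    "x \<in> set ys" "y \<in> set ys"
  shows "norm (x g - y g) \<le> real M / real (Suc M) * D"
  using assms(1,2,4,5,6)
proof (induction arbitrary: x y rule: sd_simplex.induct)
  case (Cons us ys vs)
  let ?D = "real M / real (Suc M) * D"
  have "vs \<noteq> []" using Cons.hyps by auto
  have apex: "norm (bary vs g - z g) \<le> ?D" if "z \<in> set ys" for z
  proof -
    have "set ys \<subseteq> {z. norm (z g - bary vs g) \<le> ?D}"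
    proof (rule sd_simplex_closed[OF Cons.hyps(1)])
      show "set us \<subseteq> {z. norm (z g - bary vs g) \<le> ?D}"
      proof
        fix z assume "z \<in> set us"
        then have "z \<in> set vs" using Cons.hyps(3) by auto
        then show "z \<in> {z. norm (z g - bary vs g) \<le> ?D}"
          using norm_bary_diff_vertex_le[of z vs M g D] Cons.prems(1,2) assms(3) by blast
      qed
    qed (auto intro: norm_bary_diff_le)
    then show ?thesis using that by (auto simp: norm_minus_commute)
  qed
  have apex': "norm (z g - bary vs g) \<le> ?D" if "z \<in> set ys" for z
    using apex[OF that] by (simp add: norm_minus_commute)
  have base: "norm (x g - y g) \<le> ?D" if "x \<in> set ys" "y \<in> set ys" for x y
    using Cons.IH[OF _ _ that] Cons.hyps(2,3) Cons.prems(1,2) by auto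
  have "0 \<le> ?D" using assms(3) by simp
  then show ?case
    using Cons.prems(3,4) apex apex' base by auto
qed simp

text \<open>Coning from a vertex of least level makes the levels monotone along every simplex.\<close>

lemma sd_simplex_arg_min:
  fixes f :: "'x \<Rightarrow> 'b::linorder"
  assumes "sd_simplex (arg_min_list f) vs ys"
  shows "set ys \<subseteq> set vs \<and> sorted (map f ys)"
  using assms
proof (induction rule: sd_simplex.induct)
  case (Cons us ys vs)
  then have ne: "vs \<noteq> []" by auto
  have "arg_min_list f vs \<in> set vs" by (rule arg_min_list_in[OF ne])
  moreover have "f (arg_min_list f vs) \<le> f y" if "y \<in> set vs" for y
    using that by (simp add: f_arg_min_list_f[OF ne])
  ultimately show ?case using Cons by auto
qed simp

text \<open>Ties are broken by position in the list, which \<open>map\<close> preserves; this makes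
  the relabelling equivariant although levels may repeat.\<close>

lemma arg_min_list_map:
  assumes "us \<noteq> []" "\<And>u. u \<in> set us \<Longrightarrow> f (t u) = f u"
  shows "arg_min_list f (map t us) = t (arg_min_list f us)"
  using assms
proof (induction f us rule: arg_min_list.induct)
  case (2 f x y zs)
  have "arg_min_list f (y # zs) \<in> set (y # zs)" by (rule arg_min_list_in) simp
  then have "f (t (arg_min_list f (y # zs))) = f (arg_min_list f (y # zs))"
    using 2(3) by simp
  then show ?case using 2 by (auto simp: Let_def)
qed auto

lemma chain_system_mono:
  assumes "chain_system p t M C P" "\<And>vs. P vs \<Longrightarrow> P' vs"
  shows "chain_system p t M C P'"
  using assms unfolding chain_system_def by blast

definition rotate_index :: "(int \<Rightarrow> 'v) \<Rightarrow> int \<Rightarrow> 'v" where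
  "rotate_index \<xi> g = \<xi> (g - 1)"

lemma funpow_rotate_index: "(rotate_index ^^ i) \<xi> g = \<xi> (g - int i)"
  by (induction i arbitrary: g) (auto simp: rotate_index_def algebra_simps)

text \<open>
  The simplices of the join of the orbits of \<open>b 0, b 1, \<dots>\<close>; the group \<open>\<int>/p\<close> acts on \<open>p\<close>-periodic families by shifting
  the index.
\<close>

definition orbit_simplex :: "(nat \<Rightarrow> int \<Rightarrow> 'v::real_vector) \<Rightarrow> nat \<Rightarrow> (nat \<Rightarrow> nat) \<Rightarrow> (int \<Rightarrow> 'v) set" where
  "orbit_simplex b M \<kappa> = {\<xi>. \<exists>l. (\<forall>m<M. 0 \<le> l m) \<and> (\<Sum>m<M. l m) = 1 \<and>
     (\<forall>g. \<xi> g = (\<Sum>m<M. l m *\<^sub>R b m (g - int (\<kappa> m))))}"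

lemma orbit_simplex_vertex:
  assumes "m < M"
  shows "(rotate_index ^^ \<kappa> m) (b m) \<in> orbit_simplex b M \<kappa>"
  unfolding orbit_simplex_def
  by (rule CollectI, rule exI[of _ "\<lambda>i. if i = m then 1 else 0"])
    (use assms in \<open>auto simp: funpow_rotate_index if_distrib[of "\<lambda>x. x *\<^sub>R _"] cong: if_cong\<close>)

lemma orbit_simplex_rotate:
  assumes "\<xi> \<in> orbit_simplex b M \<kappa>"
  shows "rotate_index \<xi> \<in> orbit_simplex b M (\<lambda>m. Suc (\<kappa> m))"
  using assms by (auto simp: orbit_simplex_def rotate_index_def algebra_simps)

lemma orbit_simplex_bary:
  assumes "us \<noteq> []" "set us \<subseteq> orbit_simplex b M \<kappa>"
  shows "bary us \<in> orbit_simplex b M \<kappa>"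
proof -
  have "\<forall>u\<in>set us. \<exists>l. (\<forall>m<M. 0 \<le> l m) \<and> (\<Sum>m<M. l m) = 1 \<and>
     (\<forall>g. u g = (\<Sum>m<M. l m *\<^sub>R b m (g - int (\<kappa> m))))"
    using assms(2) by (auto simp: orbit_simplex_def)
  then obtain l where l: "\<And>u m. u \<in> set us \<Longrightarrow> m < M \<Longrightarrow> 0 \<le> l u m"
    "\<And>u. u \<in> set us \<Longrightarrow> (\<Sum>m<M. l u m) = 1"
    "\<And>u g. u \<in> set us \<Longrightarrow> u g = (\<Sum>m<M. l u m *\<^sub>R b m (g - int (\<kappa> m)))"
    by metis
  define l' where "l' m = (1 / real (length us)) * (\<Sum>i<length us. l (us ! i) m)" for m
  have "0 \<le> l' m" if "m < M" for m
    unfolding l'_def using l(1) that by (intro mult_nonneg_nonneg sum_nonneg) auto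
  moreover have "(\<Sum>m<M. l' m) = 1"
  proof -
    have "(\<Sum>m<M. l' m) = (1 / real (length us)) * (\<Sum>m<M. \<Sum>i<length us. l (us ! i) m)"
      by (simp add: l'_def sum_distrib_left)
    also have "(\<Sum>m<M. \<Sum>i<length us. l (us ! i) m) = (\<Sum>i<length us. 1)"
      by (subst sum.swap) (intro sum.cong, use l(2) in auto)
    finally show ?thesis using assms(1) by simp
  qed
  moreover have "bary us g = (\<Sum>m<M. l' m *\<^sub>R b m (g - int (\<kappa> m)))" for g
  proof -
    have "(\<Sum>i<length us. (us ! i) g) = (\<Sum>i<length us. \<Sum>m<M. l (us ! i) m *\<^sub>R b m (g - int (\<kappa> m)))"
      by (intro sum.cong) (use l(3) in auto)
    also have "\<dots> = (\<Sum>m<M. (\<Sum>i<length us. l (us ! i) m) *\<^sub>R b m (g - int (\<kappa> m)))"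
      by (subst sum.swap) (simp add: scaleR_sum_left)
    finally show ?thesis by (simp add: bary_def l'_def scaleR_sum_right)
  qed
  ultimately show ?thesis unfolding orbit_simplex_def by blast
qed

section \<open>A Borsuk-Ulam theorem for cyclic groups\<close>

text \<open>
  \<open>e = 0\<close>: arguments close to \<open>2 \<pi> g / p\<close>; \<open>e = 1\<close>: arguments close to the midpoint of \<open>2 \<pi> g / p\<close> and
  \<open>2 \<pi> (g + 1) / p\<close>. For fixed \<open>e\<close> the sectors of different \<open>g\<close> are separated.
\<close>

definition in_sector :: "nat \<Rightarrow> nat \<Rightarrow> int \<Rightarrow> complex \<Rightarrow> bool" where
  "in_sector p e g z \<longleftrightarrow>
    (\<exists>x. \<bar>x - real e / 2\<bar> \<le> 1 / 4 \<and>
      z = complex_of_real (cmod z) * cis (2 * pi * (real_of_int g + x) / real p))"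

lemma in_sector_exists:
  assumes "0 < p"
  shows "\<exists>e<2. \<exists>g. in_sector p e g z"
proof -
  define s where "s = real p * Arg z / (2 * pi)"
  define x where "x = frac s"
  have s: "s = real_of_int \<lfloor>s\<rfloor> + x" by (simp add: x_def frac_def)
  have "2 * pi * s / real p = Arg z" using assms by (simp add: s_def)
  then have z: "z = complex_of_real (cmod z) * cis (2 * pi * s / real p)"
    using rcis_cmod_Arg[of z] by (simp add: rcis_def)
  have x: "0 \<le> x" "x < 1" by (auto simp: x_def frac_lt_1)
  consider "x \<le> 1 / 4" | "1 / 4 \<le> x" "x \<le> 3 / 4" | "3 / 4 \<le> x" by linarith
  then show ?thesis
  proof cases
    case 1
    have "in_sector p 0 \<lfloor>s\<rfloor> z"
      unfolding in_sector_def using 1 x z s by (intro exI[of _ x]) auto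
    then show ?thesis by (intro exI[of _ 0]) auto
  next
    case 2
    then have "\<bar>x - real 1 / 2\<bar> \<le> 1 / 4" unfolding abs_le_iff by simp
    then have "in_sector p 1 \<lfloor>s\<rfloor> z"
      unfolding in_sector_def using z s by (intro exI[of _ x]) simp
    then show ?thesis by (intro exI[of _ 1]) auto
  next
    case 3
    have "in_sector p 0 (\<lfloor>s\<rfloor> + 1) z"
      unfolding in_sector_def using 3 x z s by (intro exI[of _ "x - 1"]) (auto simp: abs_le_iff)
    then show ?thesis by (intro exI[of _ 0]) auto
  qed
qed

lemma in_sector_mult_cis:
  assumes "in_sector p e g z"
  shows "in_sector p e (g + k) (cis (2 * pi * real_of_int k / real p) * z)"
proof -
  obtain x where x: "\<bar>x - real e / 2\<bar> \<le> 1 / 4"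
    "z = complex_of_real (cmod z) * cis (2 * pi * (real_of_int g + x) / real p)"
    using assms in_sector_def by metis
  have "cis (2 * pi * real_of_int k / real p) * z
      = complex_of_real (cmod z) * (cis (2 * pi * real_of_int k / real p) * cis (2 * pi * (real_of_int g + x) / real p))"
    by (subst x(2)) (simp only: mult_ac)
  also have "\<dots> = complex_of_real (cmod z) * cis (2 * pi * (real_of_int (g + k) + x) / real p)"
    by (simp add: cis_mult add_divide_distrib distrib_left algebra_simps)
  finally show ?thesis
    unfolding in_sector_def using x(1) by (intro exI[of _ x]) (simp add: norm_mult)
qed

lemma in_sector_rotate:
  "in_sector p e (g + 1) (cis (2 * pi / real p) * z) \<longleftrightarrow> in_sector p e g z"
proof
  assume "in_sector p e (g + 1) (cis (2 * pi / real p) * z)"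
  then have "in_sector p e (g + 1 + (-1))
      (cis (2 * pi * real_of_int (-1) / real p) * (cis (2 * pi / real p) * z))"
    by (rule in_sector_mult_cis)
  then show "in_sector p e g z" by (simp add: cis_mult flip: mult.assoc)
qed (use in_sector_mult_cis[of p e g z 1] in simp)

text \<open>Law of cosines, arranged so that both summands are nonnegative for nonnegative
  radii.\<close>

lemma cmod_diff_polar:
  "(cmod (complex_of_real a * cis \<alpha> - complex_of_real b * cis \<beta>))\<^sup>2
    = (a - b)\<^sup>2 + 2 * a * b * (1 - cos (\<alpha> - \<beta>))"
proof -
  have "(cmod (complex_of_real a * cis \<alpha> - complex_of_real b * cis \<beta>))\<^sup>2
     = (a * cos \<alpha> - b * cos \<beta>)\<^sup>2 + (a * sin \<alpha> - b * sin \<beta>)\<^sup>2"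
    by (simp add: cmod_power2)
  also have "\<dots> = (a - b)\<^sup>2 + 2 * a * b * (1 - (cos \<alpha> * cos \<beta> + sin \<alpha> * sin \<beta>))"
  proof -
    have "(a * c - b * c')\<^sup>2 + (a * s - b * s')\<^sup>2 = (a - b)\<^sup>2 + 2 * a * b * (1 - (c * c' + s * s'))"
      if "s\<^sup>2 + c\<^sup>2 = 1" "s'\<^sup>2 + c'\<^sup>2 = 1" for c c' s s' :: real
    proof -
      have "(a * c - b * c')\<^sup>2 + (a * s - b * s')\<^sup>2
          = a\<^sup>2 * (s\<^sup>2 + c\<^sup>2) + b\<^sup>2 * (s'\<^sup>2 + c'\<^sup>2) - 2 * a * b * (c * c' + s * s')"
        by (simp add: power2_eq_square algebra_simps)
      then show ?thesis unfolding that by (simp add: power2_eq_square algebra_simps)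
    qed
    then show ?thesis by simp
  qed
  finally show ?thesis by (simp only: cos_diff)
qed

lemma cos_le_cos_of_between:
  assumes "0 \<le> a" "a \<le> pi" "a \<le> \<theta>" "\<theta> \<le> 2 * pi - a"
  shows "cos \<theta> \<le> cos a"
proof (cases "\<theta> \<le> pi")
  case True
  then show ?thesis using assms by (intro cos_monotone_0_pi_le) auto
next
  case False
  have "cos (2 * pi - \<theta>) \<le> cos a" using assms False by (intro cos_monotone_0_pi_le) auto
  then show ?thesis by simp
qed

text \<open>The chord of the angle \<pi> / p in a circle of radius \<eta>. For fixed e the sectors
  fill half of each period 2 \<pi> / p, which leaves gaps of angle \<pi> / p.\<close>

definition sector_gap :: "nat \<Rightarrow> real \<Rightarrow> real" where
  "sector_gap p \<eta> = \<eta> * sqrt (2 * (1 - cos (pi / real p)))"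

lemma sector_gap_pos:
  assumes "2 \<le> p" "0 < \<eta>"
  shows "0 < sector_gap p \<eta>"
proof -
  have "pi / real p \<le> pi / 2" using assms by (intro divide_left_mono) auto
  then have "cos (pi / real p) < cos 0" using assms by (intro cos_monotone_0_pi) (auto simp: field_simps)
  then show ?thesis using assms by (simp add: sector_gap_def)
qed

text \<open>If g and h differ modulo p, the angle between z and w is 2 \<pi> (d + x - y) / p with 1
  \<le> d \<le> p - 1 and x - y at most 1/2 in absolute value. It is thus at least \<pi> / p away
  from every multiple of 2 \<pi>, and the law of cosines bounds the distance below.\<close>

lemma in_sector_separated:
  assumes p: "2 \<le> p" and "in_sector p e g z" "in_sector p e h w"
    and \<eta>: "0 < \<eta>" "\<eta> \<le> cmod z" "\<eta> \<le> cmod w" and "cmod (z - w) < sector_gap p \<eta>"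
  shows "[g = h] (mod int p)"
proof (rule ccontr)
  assume ncong: "\<not> [g = h] (mod int p)"
  obtain x y where x: "\<bar>x - real e / 2\<bar> \<le> 1 / 4"
      "z = complex_of_real (cmod z) * cis (2 * pi * (real_of_int g + x) / real p)"
    and y: "\<bar>y - real e / 2\<bar> \<le> 1 / 4"
      "w = complex_of_real (cmod w) * cis (2 * pi * (real_of_int h + y) / real p)"
    using assms(2,3) in_sector_def by metis
  define d where "d = (g - h) mod int p"
  define q where "q = (g - h) div int p"
  have gh: "g - h = int p * q + d" by (simp add: d_def q_def)
  have "d \<noteq> 0" using ncong by (auto simp: d_def cong_iff_dvd_diff)
  then have d: "1 \<le> d" "d \<le> int p - 1"
    using p pos_mod_bound[of "int p" "g - h"] pos_mod_sign[of "int p" "g - h"] unfolding d_def by linarith+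
  define \<theta> where "\<theta> = 2 * pi * (real_of_int d + (x - y)) / real p"
  have "real_of_int g - real_of_int h = real p * real_of_int q + real_of_int d"
    using gh by (metis of_int_add of_int_diff of_int_mult of_int_of_nat_eq)
  then have eq: "2 * pi * (real_of_int g + x) / real p - 2 * pi * (real_of_int h + y) / real p
      = \<theta> + of_int q * (2 * pi)"
    using p by (simp add: \<theta>_def field_simps) algebra
  have xy: "\<bar>x - y\<bar> \<le> 1 / 2" using x(1) y(1) by linarith
  have "cos (2 * pi * (real_of_int g + x) / real p - 2 * pi * (real_of_int h + y) / real p) = cos \<theta>"
    unfolding eq using sin_int_2pin[of q] cos_int_2pin[of q]
    by (simp add: cos_add mult.commute mult.left_commute)
  also have "\<dots> \<le> cos (pi / real p)"
  proof (rule cos_le_cos_of_between)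
    have "1 / 2 \<le> real_of_int d + (x - y)" using d(1) xy by linarith
    then have "2 * pi * (1 / 2) \<le> 2 * pi * (real_of_int d + (x - y))" by (intro mult_left_mono) auto
    then show "pi / real p \<le> \<theta>" using p unfolding \<theta>_def by (intro divide_right_mono) auto
    have "real_of_int d + (x - y) \<le> real p - 1 / 2" using d(2) xy by linarith
    then have "2 * pi * (real_of_int d + (x - y)) \<le> 2 * pi * (real p - 1 / 2)" by (intro mult_left_mono) auto
    then have "\<theta> \<le> 2 * pi * (real p - 1 / 2) / real p" unfolding \<theta>_def by (intro divide_right_mono) auto
    also have "\<dots> = 2 * pi - pi / real p" using p by (simp add: field_simps)
    finally show "\<theta> \<le> 2 * pi - pi / real p" .
  qed (use p in \<open>auto simp: field_simps\<close>)
  finally have cos_le: "cos (2 * pi * (real_of_int g + x) / real p - 2 * pi * (real_of_int h + y) / real p)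
      \<le> cos (pi / real p)" .
  have "(sector_gap p \<eta>)\<^sup>2 = 2 * (\<eta> * \<eta>) * (1 - cos (pi / real p))"
    by (simp add: sector_gap_def power_mult_distrib power2_eq_square)
  also have "\<dots> \<le> 2 * (cmod z * cmod w) * (1 - cos (pi / real p))"
    using \<eta> by (intro mult_right_mono mult_left_mono mult_mono) auto
  also have "\<dots> \<le> 2 * (cmod z * cmod w)
      * (1 - cos (2 * pi * (real_of_int g + x) / real p - 2 * pi * (real_of_int h + y) / real p))"
    using cos_le by (intro mult_left_mono) auto
  also have "\<dots> \<le> (cmod (z - w))\<^sup>2"
  proof -
    have "(cmod (z - w))\<^sup>2 = (cmod z - cmod w)\<^sup>2 + 2 * cmod z * cmod w
      * (1 - cos (2 * pi * (real_of_int g + x) / real p - 2 * pi * (real_of_int h + y) / real p))"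
      unfolding cmod_diff_polar[symmetric] using x(2) y(2) by simp
    then show ?thesis by simp
  qed
  finally have "sector_gap p \<eta> \<le> cmod (z - w)" by (rule power2_le_imp_le) simp
  then show False using assms(7) by simp
qed

lemma sorted_distinct_adj_imp_distinct:
  fixes xs :: "'a::linorder list"
  shows "sorted xs \<Longrightarrow> distinct_adj xs \<Longrightarrow> distinct xs"
proof (induction xs rule: induct_list012)
  case (3 x y zs)
  then have "distinct (y # zs)" "x < y" "\<forall>z\<in>set (y # zs). y \<le> z" by auto
  moreover from this have "x \<notin> set (y # zs)" by force
  ultimately show ?case by simp
qed auto

text \<open>Without an approximate zero, every point has a level among 2n (a coordinate of modulus
  at least \<eta> and a type of sector) and the index of its sector as label. Nearby points of equal
  level have equal labels. On a small simplex sorted by level, the 2n + 1 vertices with distinct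
  adjacent labels from \<open>Zp_Tucker\<close> would have 2n + 1 distinct levels.\<close>

theorem Zp_Borsuk_Ulam_approx:
  fixes F :: "(int \<Rightarrow> 'v::real_normed_vector) \<Rightarrow> nat \<Rightarrow> complex" and b :: "nat \<Rightarrow> int \<Rightarrow> 'v"
    and n :: nat
  defines "K \<equiv> orbit_simplex b (2 * n + 1)"
  assumes p: "2 \<le> p" and n: "1 \<le> n"
    and per: "\<And>m g. b m (g - int p) = b m g"
    and bounded: "\<And>m g. norm (b m g) \<le> B"
    and equiv: "\<And>\<xi> \<kappa> c. \<xi> \<in> K \<kappa> \<Longrightarrow> c < n \<Longrightarrow> F (rotate_index \<xi>) c = cis (2 * pi / real p) * F \<xi> c"
    and ucont: "\<And>e. 0 < e \<Longrightarrow> \<exists>\<delta>>0. \<forall>\<kappa> \<kappa>'. \<forall>\<xi>\<in>K \<kappa>. \<forall>\<xi>'\<in>K \<kappa>'.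
      (\<forall>g. norm (\<xi> g - \<xi>' g) < \<delta>) \<longrightarrow> (\<forall>c<n. cmod (F \<xi> c - F \<xi>' c) < e)"
    and \<eta>: "0 < \<eta>"
  shows "\<exists>\<kappa>. \<exists>\<xi>\<in>K \<kappa>. \<forall>c<n. cmod (F \<xi> c) < \<eta>"
proof (rule ccontr)
  assume "\<not> ?thesis"
  then have nonzero: "\<exists>c<n. \<eta> \<le> cmod (F \<xi> c)" if "\<xi> \<in> K \<kappa>" for \<xi> \<kappa>
    using that by (meson not_le)
  \<comment> \<open>The level i = 2c + e encodes the coordinate c and the type e of the
    sector.\<close>
  define S where "S i g \<xi> \<longleftrightarrow> i < 2 * n \<and> \<eta> \<le> cmod (F \<xi> (i div 2)) \<and> in_sector p (i mod 2) g (F \<xi> (i div 2))"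
    for i g \<xi>
  define lev where "lev \<xi> = (LEAST i. \<exists>g. S i g \<xi>)" for \<xi>
  \<comment> \<open>Modulo \<open>p\<close> the label does not depend on the choice of g:
    \<open>S_close\<close>, applied to a point and itself, makes all candidates congruent.\<close>
  define lab where "lab \<xi> = (SOME g. S (lev \<xi>) g \<xi>) mod int p" for \<xi>
  define KK where "KK = (\<Union>\<kappa>. K \<kappa>)"
  have S_ex: "\<exists>i g. S i g \<xi>" if "\<xi> \<in> KK" for \<xi>
  proof -
    obtain c where c: "c < n" "\<eta> \<le> cmod (F \<xi> c)" using \<open>\<xi> \<in> KK\<close> nonzero unfolding KK_def by blast
    obtain e g where "e < 2" "in_sector p e g (F \<xi> c)" using in_sector_exists[of p "F \<xi> c"] p by auto
    then have "S (2 * c + e) g \<xi>" using c by (auto simp: S_def)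
    then show ?thesis by blast
  qed
  have S_lev: "\<exists>g. S (lev \<xi>) g \<xi>" if "\<xi> \<in> KK" for \<xi>
    unfolding lev_def by (rule LeastI_ex) (rule S_ex[OF that])
  have S_close: "[g = h] (mod int p)"
    if "S i g \<xi>" "S i h \<xi>'" "\<And>c. c < n \<Longrightarrow> cmod (F \<xi> c - F \<xi>' c) < sector_gap p \<eta>" for i g h \<xi> \<xi>'
    using that(1,2) that(3)[of "i div 2"] unfolding S_def
    by (intro in_sector_separated[OF p _ _ \<eta>]) auto
  have S_lab: "\<exists>g. S (lev \<xi>) g \<xi> \<and> lab \<xi> = g mod int p" if "\<xi> \<in> KK" for \<xi>
    using someI_ex[OF S_lev[OF that]] lab_def by blast
  have lab_eq: "lab \<xi> = lab \<xi>'"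
    if "\<xi> \<in> KK" "\<xi>' \<in> KK" "lev \<xi> = lev \<xi>'"
      "\<And>c. c < n \<Longrightarrow> cmod (F \<xi> c - F \<xi>' c) < sector_gap p \<eta>" for \<xi> \<xi>'
    using S_lab[OF that(1)] S_lab[OF that(2)] S_close[OF _ _ that(4)] that(3)
    by (metis cong_def)
  have KK_rot: "rotate_index \<xi> \<in> KK" if "\<xi> \<in> KK" for \<xi>
    using that orbit_simplex_rotate unfolding KK_def K_def by blast
  have S_rot: "S i (g + 1) (rotate_index \<xi>) \<longleftrightarrow> S i g \<xi>" if "\<xi> \<in> KK" for i g \<xi>
  proof -
    obtain \<kappa> where \<kappa>: "\<xi> \<in> K \<kappa>" using \<open>\<xi> \<in> KK\<close> KK_def by auto
    show ?thesis
    proof (cases "i < 2 * n")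
      case True
      then have "F (rotate_index \<xi>) (i div 2) = cis (2 * pi / real p) * F \<xi> (i div 2)"
        by (intro equiv[OF \<kappa>]) auto
      then show ?thesis by (simp add: S_def in_sector_rotate norm_mult)
    qed (simp add: S_def)
  qed
  have lev_rot: "lev (rotate_index \<xi>) = lev \<xi>" if "\<xi> \<in> KK" for \<xi>
  proof -
    have "(\<exists>g. S i g (rotate_index \<xi>)) \<longleftrightarrow> (\<exists>g. S i g \<xi>)" for i
      using S_rot[OF that, of i] by (metis diff_add_cancel)
    then show ?thesis by (simp add: lev_def)
  qed
  have lab_rot: "lab (rotate_index \<xi>) = rotate_residue (int p) (lab \<xi>)" if "\<xi> \<in> KK" for \<xi>
  proof -
    obtain g where g: "S (lev \<xi>) g \<xi>" "lab \<xi> = g mod int p" using S_lab[OF \<open>\<xi> \<in> KK\<close>] by blast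
    obtain h where h: "S (lev \<xi>) h (rotate_index \<xi>)" "lab (rotate_index \<xi>) = h mod int p"
      using S_lab[OF KK_rot[OF \<open>\<xi> \<in> KK\<close>]] lev_rot[OF \<open>\<xi> \<in> KK\<close>] by auto
    have "[g + 1 = h] (mod int p)"
      by (rule S_close[OF _ h(1)]) (use S_rot[OF that] g(1) sector_gap_pos[OF p \<eta>] in auto)
    then show ?thesis using g(2) h(2) by (simp add: rotate_residue_def cong_def mod_simps)
  qed
  have KK_funpow: "(rotate_index ^^ i) \<xi> \<in> KK" if "\<xi> \<in> KK" for \<xi> i
    using that KK_rot by (induction i) auto
  have lab_funpow: "lab ((rotate_index ^^ i) \<xi>) = (rotate_residue (int p) ^^ i) (lab \<xi>)"
    if "\<xi> \<in> KK" for \<xi> i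
    using lab_rot KK_funpow[OF that] by (induction i) auto

  \<comment> \<open>The factor by which one barycentric subdivision shrinks simplices with at most
    2n + 1 vertices. The initial diameter is at most 2B.\<close>
  define R where "R = real (2 * n) / real (Suc (2 * n))"
  have R: "0 \<le> R" "R < 1" by (auto simp: R_def)
  define small where "small k vs \<longleftrightarrow> (\<exists>\<kappa>. set vs \<subseteq> K \<kappa>) \<and>
    (\<forall>g. \<forall>u\<in>set vs. \<forall>v\<in>set vs. norm (u g - v g) \<le> R ^ k * (2 * B))" for k vs
  have small_rot: "small k (map rotate_index vs)" if vs: "small k vs" for k vs
  proof -
    obtain \<kappa> where "set vs \<subseteq> K \<kappa>" using vs small_def by auto
    then have "set (map rotate_index vs) \<subseteq> K (\<lambda>m. Suc (\<kappa> m))"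
      unfolding K_def by (auto intro!: orbit_simplex_rotate dest: subsetD)
    moreover have "\<forall>g. \<forall>u\<in>set (map rotate_index vs). \<forall>v\<in>set (map rotate_index vs).
        norm (u g - v g) \<le> R ^ k * (2 * B)"
      using vs by (simp add: small_def rotate_index_def)
    ultimately show ?thesis unfolding small_def by blast
  qed
  have B: "0 \<le> B" using order_trans[OF norm_ge_zero bounded] .
  have systems: "\<exists>C. chain_system p rotate_index (2 * n + 1) C (small k)" for k
  proof (induction k)
    case 0
    have "(rotate_index ^^ p) (b m) = b m" for m
      by (rule ext) (simp add: funpow_rotate_index per)
    then have "chain_system p rotate_index (2 * n + 1) (cone_chain p rotate_index b)
      (partial_orbit_list rotate_index b (2 * n + 1))" by (rule cone_chain_system)
    moreover have "small 0 vs" if vs: "partial_orbit_list rotate_index b (2 * n + 1) vs" for vs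
    proof -
      obtain \<kappa> where \<kappa>: "set vs \<subseteq> (\<lambda>m. (rotate_index ^^ \<kappa> m) (b m)) ` {..<2 * n + 1}"
        using vs partial_orbit_list_def by metis
      moreover have "(\<lambda>m. (rotate_index ^^ \<kappa> m) (b m)) ` {..<2 * n + 1} \<subseteq> K \<kappa>"
        unfolding K_def by (intro image_subsetI orbit_simplex_vertex) simp
      ultimately have "set vs \<subseteq> K \<kappa>" by (rule subset_trans)
      moreover have "norm (u g - v g) \<le> 2 * B" if "u \<in> set vs" "v \<in> set vs" for u v g
      proof -
        have "norm (w g) \<le> B" if "w \<in> set vs" for w
          using subsetD[OF \<kappa> that] bounded by (auto simp: funpow_rotate_index)
        from this[OF that(1)] this[OF that(2)] show ?thesis
          using norm_triangle_ineq4[of "u g" "v g"] by linarith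
      qed
      ultimately show ?thesis unfolding small_def by auto
    qed
    ultimately show ?case by (blast intro: chain_system_mono)
  next
    case (Suc k)
    then obtain C where C: "chain_system p rotate_index (2 * n + 1) C (small k)" by blast
    have "chain_system p rotate_index (2 * n + 1) (\<lambda>j w. C j (sd bary w)) (small (Suc k))"
    proof (rule sd_chain_system[OF C])
      fix vs us assume "small k vs" "set us \<subseteq> set vs"
      then show "small k us" unfolding small_def by blast
    next
      fix vs assume "small k vs"
      then show "small k (map rotate_index vs)" by (rule small_rot)
    next
      fix vs :: "(int \<Rightarrow> 'v) list" show "bary (map rotate_index vs) = rotate_index (bary vs)"
        by (rule ext) (simp add: bary_def rotate_index_def)
    next
      fix vs ys assume vs: "small k vs" "length vs \<le> 2 * n + 1" "sd_simplex bary vs ys"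
      obtain \<kappa> where \<kappa>: "set vs \<subseteq> K \<kappa>" using vs(1) small_def by auto
      have "set ys \<subseteq> K \<kappa>"
        by (rule sd_simplex_closed[OF vs(3) _ \<kappa>]) (auto simp: K_def intro: orbit_simplex_bary)
      moreover have "norm (x g - y g) \<le> R * (R ^ k * (2 * B))" if "x \<in> set ys" "y \<in> set ys" for x y g
        unfolding R_def
        by (rule sd_bary_mesh[OF vs(3)]) (use vs that B R in \<open>auto simp: small_def R_def\<close>)
      ultimately show "small (Suc k) ys" by (auto simp: small_def mult_ac)
    qed
    then show ?case by blast
  qed

  obtain \<delta> where \<delta>: "0 < \<delta>" and F_close: "\<And>\<kappa> \<kappa>' \<xi> \<xi>' c. \<xi> \<in> K \<kappa> \<Longrightarrow> \<xi>' \<in> K \<kappa>' \<Longrightarrow>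
      (\<And>g. norm (\<xi> g - \<xi>' g) < \<delta>) \<Longrightarrow> c < n \<Longrightarrow> cmod (F \<xi> c - F \<xi>' c) < sector_gap p \<eta>"
    using ucont[OF sector_gap_pos[OF p \<eta>]] by metis
  obtain k where k: "R ^ k * (2 * B) < \<delta>"
  proof (cases "B = 0")
    case True
    then show ?thesis using that[of 0] \<delta> by simp
  next
    case False
    then obtain k where "R ^ k < \<delta> / (2 * B)"
      using real_arch_pow_inv[of "\<delta> / (2 * B)" R] R \<delta> B by auto
    then show ?thesis using that[of k] False B by (simp add: field_simps)
  qed
  obtain C where C: "chain_system p rotate_index (2 * n + 1) C (small k)" using systems by blast
  have small_KK: "set vs \<subseteq> KK" if "small k vs" for vs using that by (auto simp: small_def KK_def)
  \<comment> \<open>A last subdivision without new vertices arranges the vertices of each simplex by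
    level, in preparation for the pigeonhole argument.\<close>
  define P where "P ys \<longleftrightarrow> (\<exists>vs. small k vs \<and> sd_simplex (arg_min_list lev) vs ys)" for ys
  have "chain_system p rotate_index (2 * n + 1) (\<lambda>j w. C j (sd (arg_min_list lev) w)) P"
  proof (rule sd_chain_system[OF C])
    fix vs us assume "small k vs" "set us \<subseteq> set vs"
    then show "small k us" unfolding small_def by blast
  next
    fix vs assume "small k vs"
    then show "small k (map rotate_index vs)" by (rule small_rot)
  next
    fix vs assume "vs \<noteq> []" "small k vs"
    then show "arg_min_list lev (map rotate_index vs) = rotate_index (arg_min_list lev vs)"
      using lev_rot small_KK by (intro arg_min_list_map) auto
  qed (auto simp: P_def)
  moreover have P_KK: "v \<in> KK" if "P vs" "v \<in> set vs" for vs v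
    using that small_KK sd_simplex_arg_min unfolding P_def by blast
  moreover have "lab v \<in> {0..<int p}" for v using p by (simp add: lab_def)
  ultimately obtain ys where ys: "P ys" "length ys = 2 * n + 1" "distinct_adj (map lab ys)"
    using Zp_Tucker[OF p n, of rotate_index _ P lab] lab_funpow by metis
  then obtain vs where vs: "small k vs" "sd_simplex (arg_min_list lev) vs ys" using P_def by blast
  have sub: "set ys \<subseteq> set vs" "sorted (map lev ys)" using sd_simplex_arg_min[OF vs(2)] by auto
  have "lab u = lab v" if "u \<in> set ys" "v \<in> set ys" "lev u = lev v" for u v
  proof (rule lab_eq)
    obtain \<kappa> where "set vs \<subseteq> K \<kappa>" using vs(1) small_def by auto
    moreover have "norm (u g - v g) < \<delta>" for g
      using vs(1) sub(1) that k unfolding small_def by (meson le_less_trans subsetD)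
    ultimately show "cmod (F u c - F v c) < sector_gap p \<eta>" if "c < n" for c
      using F_close that sub(1) \<open>u \<in> set ys\<close> \<open>v \<in> set ys\<close> by (meson subsetD)
  qed (use that P_KK ys(1) in auto)
  then have "distinct_adj (map lev ys)"
    using ys(3) unfolding distinct_adj_conv_nth by (metis Suc_lessD length_map nth_map nth_mem)
  then have "distinct (map lev ys)"
    using sub(2) sorted_distinct_adj_imp_distinct by blast
  moreover have "lev u < 2 * n" if "u \<in> set ys" for u
    using S_lev[OF P_KK[OF ys(1) that]] by (auto simp: S_def)
  ultimately have "length (map lev ys) \<le> card {..<2 * n}"
    unfolding distinct_card[symmetric] by (metis (no_types, lifting) card_mono distinct_card finite_lessThan image_subsetI lessThan_iff list.set_map)
  then show False using ys(2) by simp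
qed

text \<open>Weights are extended by zero beyond M, which makes the simplex a closed subset of a
  product of unit intervals and hence compact.\<close>

definition weight_simplex :: "nat \<Rightarrow> (nat \<Rightarrow> real) set" where
  "weight_simplex M = {l. (\<forall>m. 0 \<le> l m) \<and> (\<forall>m\<ge>M. l m = 0) \<and> (\<Sum>m<M. l m) = 1}"

definition weighted_point ::
  "(nat \<Rightarrow> int \<Rightarrow> 'v::real_vector) \<Rightarrow> nat \<Rightarrow> (nat \<Rightarrow> nat) \<Rightarrow> (nat \<Rightarrow> real) \<Rightarrow> int \<Rightarrow> 'v" where
  "weighted_point b M \<kappa> l g = (\<Sum>m<M. l m *\<^sub>R b m (g - int (\<kappa> m)))"

lemma orbit_simplex_eq: "orbit_simplex b M \<kappa> = weighted_point b M \<kappa> ` weight_simplex M"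
proof (intro equalityI subsetI)
  fix \<xi> assume "\<xi> \<in> orbit_simplex b M \<kappa>"
  then obtain l where l: "\<forall>m<M. 0 \<le> l m" "(\<Sum>m<M. l m) = 1"
    "\<forall>g. \<xi> g = (\<Sum>m<M. l m *\<^sub>R b m (g - int (\<kappa> m)))" by (auto simp: orbit_simplex_def)
  define l' where "l' m = (if m < M then l m else 0)" for m
  have "l' \<in> weight_simplex M" using l(1,2) by (auto simp: weight_simplex_def l'_def)
  moreover have "\<xi> = weighted_point b M \<kappa> l'"
    by (rule ext) (simp add: weighted_point_def l(3) l'_def)
  ultimately show "\<xi> \<in> weighted_point b M \<kappa> ` weight_simplex M" by blast
qed (auto simp: orbit_simplex_def weighted_point_def weight_simplex_def)

lemma compact_weight_simplex: "compact (weight_simplex M)"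
proof -
  have cont: "continuous_on UNIV (\<lambda>l::nat \<Rightarrow> real. l m)" for m
    by (rule continuous_on_product_coordinates)
  have "closed ({l. (\<forall>m. 0 \<le> l m) \<and> (\<forall>m. M \<le> m \<longrightarrow> l m = 0) \<and> (\<Sum>m<M. l m) = (1::real)})"
    by (intro closed_Collect_conj closed_Collect_all closed_Collect_imp closed_Collect_le
        closed_Collect_eq continuous_intros cont) auto
  then have "closed (weight_simplex M)" by (simp add: weight_simplex_def)
  moreover have "compact (PiE UNIV (\<lambda>_. {0..1}) :: (nat \<Rightarrow> real) set)"
  proof -
    have "compactin (product_topology (\<lambda>_::nat. euclidean) UNIV) (PiE UNIV (\<lambda>_. {0..1::real}))"
      unfolding compactin_PiE by simp
    then show ?thesis by (simp add: euclidean_product_topology)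
  qed
  moreover have "weight_simplex M \<subseteq> PiE UNIV (\<lambda>_. {0..1})"
  proof
    fix l assume l: "l \<in> weight_simplex M"
    have "l m \<le> 1" for m
    proof (cases "m < M")
      case True
      then have "l m \<le> (\<Sum>m<M. l m)" using l by (intro member_le_sum) (auto simp: weight_simplex_def)
      then show ?thesis using l by (simp add: weight_simplex_def)
    qed (use l in \<open>auto simp: weight_simplex_def\<close>)
    then show "l \<in> PiE UNIV (\<lambda>_. {0..1})" using l by (auto simp: weight_simplex_def)
  qed
  ultimately show ?thesis
    by (metis compact_Int_closed inf.absorb_iff2 inf.commute)
qed

lemma weight_simplex_nonempty: "0 < M \<Longrightarrow> weight_simplex M \<noteq> {}"
proof -
  assume "0 < M"
  then have "(\<lambda>m. if m = 0 then 1 else 0) \<in> weight_simplex M" by (auto simp: weight_simplex_def)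
  then show ?thesis by blast
qed

text \<open>By periodicity only the residues of \<open>\<kappa>\<close> matter, so the join has
  finitely many simplices and a minimum over them exists.\<close>

lemma weighted_point_mod:
  assumes "\<And>m g. b m (g - int p) = b m g"
  shows "weighted_point b M \<kappa> = weighted_point b M (restrict (\<lambda>m. \<kappa> m mod p) {..<M})"
proof -
  have shift: "b m (g - int (p * q)) = b m g" for m g q
    using assms[of m "g - int (p * q)" for q] by (induction q) (auto simp: algebra_simps)
  have "b m (g - int (\<kappa> m)) = b m (g - int (\<kappa> m mod p))" for m g
  proof -
    have "int (\<kappa> m) = int (\<kappa> m mod p) + int (p * (\<kappa> m div p))"
      by (metis mod_mult_div_eq of_nat_add)
    then show ?thesis using shift[of m "g - int (\<kappa> m mod p)" "\<kappa> m div p"]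
      by (simp add: algebra_simps)
  qed
  then show ?thesis by (intro ext) (simp add: weighted_point_def)
qed

text \<open>Without a zero, the sum of the moduli has a positive minimum on each compact simplex,
  and only finitely many simplices occur. An approximate zero below this bound is a
  contradiction.\<close>

theorem Zp_Borsuk_Ulam:
  fixes F :: "(int \<Rightarrow> 'v::real_normed_vector) \<Rightarrow> nat \<Rightarrow> complex" and b :: "nat \<Rightarrow> int \<Rightarrow> 'v"
    and n :: nat
  defines "K \<equiv> orbit_simplex b (2 * n + 1)"
  assumes p: "2 \<le> p" and n: "1 \<le> n"
    and per: "\<And>m g. b m (g - int p) = b m g"
    and bounded: "\<And>m g. norm (b m g) \<le> B"
    and equiv: "\<And>\<xi> \<kappa> c. \<xi> \<in> K \<kappa> \<Longrightarrow> c < n \<Longrightarrow> F (rotate_index \<xi>) c = cis (2 * pi / real p) * F \<xi> c"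
    and ucont: "\<And>e. 0 < e \<Longrightarrow> \<exists>\<delta>>0. \<forall>\<kappa> \<kappa>'. \<forall>\<xi>\<in>K \<kappa>. \<forall>\<xi>'\<in>K \<kappa>'.
      (\<forall>g. norm (\<xi> g - \<xi>' g) < \<delta>) \<longrightarrow> (\<forall>c<n. cmod (F \<xi> c - F \<xi>' c) < e)"
  shows "\<exists>\<kappa>. \<exists>\<xi>\<in>K \<kappa>. \<forall>c<n. F \<xi> c = 0"
proof (rule ccontr)
  assume "\<not> ?thesis"
  then have nonzero: "\<exists>c<n. F \<xi> c \<noteq> 0" if "\<xi> \<in> K \<kappa>" for \<xi> \<kappa>
    using that by blast
  define M where "M = 2 * n + 1"
  let ?W = "weight_simplex M" and ?P = "weighted_point b M"
  have K: "K \<kappa> = ?P \<kappa> ` ?W" for \<kappa> by (simp add: K_def M_def orbit_simplex_eq)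
  have B: "0 \<le> B" using order_trans[OF norm_ge_zero bounded] .
  have cont: "continuous_on ?W (\<lambda>l. F (?P \<kappa> l) c)" if "c < n" for \<kappa> c
    unfolding continuous_on_def
  proof (intro ballI tendstoI)
    fix l e assume l: "l \<in> ?W" and "0 < (e::real)"
    then obtain \<delta> where \<delta>: "0 < \<delta>" and close: "\<And>\<xi> \<xi>'. \<xi> \<in> K \<kappa> \<Longrightarrow> \<xi>' \<in> K \<kappa> \<Longrightarrow>
        (\<forall>g. norm (\<xi> g - \<xi>' g) < \<delta>) \<Longrightarrow> cmod (F \<xi> c - F \<xi>' c) < e"
      using ucont \<open>c < n\<close> by metis
    have "continuous_on UNIV (\<lambda>l'. \<Sum>m<M. \<bar>l' m - l m\<bar> * B)"
      by (intro continuous_intros continuous_on_product_coordinates)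
    then have "((\<lambda>l'. \<Sum>m<M. \<bar>l' m - l m\<bar> * B) \<longlongrightarrow> (\<Sum>m<M. \<bar>l m - l m\<bar> * B)) (at l within ?W)"
      by (meson UNIV_I continuous_on_def subset_UNIV tendsto_within_subset)
    then have "\<forall>\<^sub>F l' in at l within ?W. (\<Sum>m<M. \<bar>l' m - l m\<bar> * B) < \<delta>"
      using \<delta> by (intro order_tendstoD(2)[where y = 0]) simp_all
    moreover have "\<forall>\<^sub>F l' in at l within ?W. l' \<in> ?W"
      by (simp add: eventually_at_filter)
    ultimately show "\<forall>\<^sub>F l' in at l within ?W. dist (F (?P \<kappa> l') c) (F (?P \<kappa> l) c) < e"
    proof eventually_elim
      case (elim l')
      have "norm (?P \<kappa> l' g - ?P \<kappa> l g) < \<delta>" for g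
      proof -
        have "?P \<kappa> l' g - ?P \<kappa> l g = (\<Sum>m<M. (l' m - l m) *\<^sub>R b m (g - int (\<kappa> m)))"
          by (simp add: weighted_point_def scaleR_diff_left sum_subtractf)
        also have "norm \<dots> \<le> (\<Sum>m<M. \<bar>l' m - l m\<bar> * B)"
          by (rule sum_norm_le) (simp add: mult_left_mono bounded)
        finally show ?thesis using elim(1) by simp
      qed
      then show ?case unfolding dist_norm using l elim(2) by (intro close) (auto simp: K)
    qed
  qed
  have "\<exists>s>0. \<forall>\<xi>\<in>K \<kappa>. s \<le> (\<Sum>c<n. cmod (F \<xi> c))" for \<kappa>
  proof -
    have "continuous_on ?W (\<lambda>l. \<Sum>c<n. cmod (F (?P \<kappa> l) c))"
      by (intro continuous_intros cont) auto
    moreover have "?W \<noteq> {}" by (rule weight_simplex_nonempty) (simp add: M_def)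
    ultimately
    obtain l where l: "l \<in> ?W"
      "\<And>l'. l' \<in> ?W \<Longrightarrow> (\<Sum>c<n. cmod (F (?P \<kappa> l) c)) \<le> (\<Sum>c<n. cmod (F (?P \<kappa> l') c))"
      using continuous_attains_inf[OF compact_weight_simplex] by metis
    obtain c where c: "c < n" "F (?P \<kappa> l) c \<noteq> 0" using nonzero[of "?P \<kappa> l" \<kappa>] l(1) K by auto
    have "0 < (\<Sum>c<n. cmod (F (?P \<kappa> l) c))"
      by (rule sum_pos2[of _ c]) (use c in auto)
    then show ?thesis using l(2) K by auto
  qed
  then obtain s where s: "\<And>\<kappa>. 0 < s \<kappa>" "\<And>\<kappa> \<xi>. \<xi> \<in> K \<kappa> \<Longrightarrow> s \<kappa> \<le> (\<Sum>c<n. cmod (F \<xi> c))"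
    by metis
  define \<Phi> where "\<Phi> = PiE {..<M} (\<lambda>_. {..<p})"
  have \<Phi>: "finite \<Phi>" "restrict (\<lambda>m. \<kappa> m mod p) {..<M} \<in> \<Phi>" for \<kappa>
    using p by (auto simp: \<Phi>_def intro: finite_PiE)
  \<comment> \<open>n coordinates of modulus below this value have a sum below the least of the
    minima.\<close>
  define \<eta> where "\<eta> = Min (s ` \<Phi>) / real n"
  have "\<Phi> \<noteq> {}" using \<Phi>(2) by blast
  then have "0 < \<eta>" using \<Phi>(1) s(1) n by (simp add: \<eta>_def)
  have "\<exists>\<kappa>. \<exists>\<xi>\<in>orbit_simplex b (2 * n + 1) \<kappa>. \<forall>c<n. cmod (F \<xi> c) < \<eta>"
    by (rule Zp_Borsuk_Ulam_approx[OF p n])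
      (fact per bounded equiv[unfolded K_def] ucont[unfolded K_def] \<open>0 < \<eta>\<close>)+
  then obtain \<kappa> \<xi> where \<xi>: "\<xi> \<in> K \<kappa>" "\<And>c. c < n \<Longrightarrow> cmod (F \<xi> c) < \<eta>"
    unfolding K_def by blast
  let ?\<kappa> = "restrict (\<lambda>m. \<kappa> m mod p) {..<M}"
  have "Min (s ` \<Phi>) \<le> s ?\<kappa>" using \<Phi> by simp
  also have "\<dots> \<le> (\<Sum>c<n. cmod (F \<xi> c))"
    using \<xi>(1) weighted_point_mod[where b = b and p = p and M = M and \<kappa> = \<kappa>, OF per]
    by (intro s(2)) (simp add: K)
  also have "\<dots> < (\<Sum>c<n. \<eta>)" by (rule sum_strict_mono) (use n \<xi>(2) in \<open>auto simp: lessThan_empty_iff\<close>)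
  also have "\<dots> = Min (s ` \<Phi>)" using n by (simp add: \<eta>_def)
  finally show False by simp
qed

section \<open>Vanishing character sums over points with disjoint supports\<close>

text \<open>At \<open>t = 0\<close> the quotient is \<open>0\<close> by convention, and so is the value.\<close>

definition homogenize :: "('a::real_vector \<Rightarrow> 'c::real_vector) \<Rightarrow> real \<times> 'a \<Rightarrow> 'c" where
  "homogenize \<phi> z = fst z *\<^sub>R \<phi> (snd z /\<^sub>R fst z)"

text \<open>A point of the join is recorded as (t, t x), which is meaningful also at t = 0, where x
  is undetermined; \<open>homogenize\<close> recovers t times the value at x from it.\<close>

definition unit_cone :: "'a::real_vector set \<Rightarrow> (real \<times> 'a) set" where
  "unit_cone S = (\<lambda>(t, x). (t, t *\<^sub>R x)) ` ({0..1} \<times> S)"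

lemma homogenize_scaled: "homogenize \<phi> (t, t *\<^sub>R x) = t *\<^sub>R \<phi> x"
  by (cases "t = 0") (simp_all add: homogenize_def)

lemma compact_unit_cone:
  fixes S :: "'a::real_normed_vector set"
  assumes "compact S"
  shows "compact (unit_cone S)"
  unfolding unit_cone_def
  by (intro compact_continuous_image compact_Times assms)
    (auto simp: case_prod_unfold intro!: continuous_intros)

text \<open>The map \<open>(t, x) \<mapsto> (t, t x)\<close> is a closed map on a compact set, so continuity descends to its image.\<close>

lemma continuous_on_homogenize:
  fixes S :: "'a::real_normed_vector set" and \<phi> :: "'a \<Rightarrow> 'c::real_normed_vector"
  assumes "compact S" "continuous_on S \<phi>"
  shows "continuous_on (unit_cone S) (homogenize \<phi>)"
  unfolding continuous_on_closed_invariant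
proof (intro allI impI)
  fix D :: "'c set" assume "closed D"
  let ?P = "{0..1::real} \<times> S" and ?q = "\<lambda>(t, x). (t::real, t *\<^sub>R (x::'a))"
  let ?E = "(\<lambda>z. fst z *\<^sub>R \<phi> (snd z)) -` D \<inter> ?P"
  have "continuous_on ?P (\<lambda>z. fst z *\<^sub>R \<phi> (snd z))"
    by (intro continuous_intros continuous_on_compose2[OF assms(2)]) auto
  then obtain A where "closed A" "A \<inter> ?P = ?E"
    using \<open>closed D\<close> unfolding continuous_on_closed_invariant by metis
  then have "compact ?E" using assms(1) by (metis compact_Icc compact_Int_closed compact_Times inf_commute)
  then have "compact (?q ` ?E)"
    by (rule compact_continuous_image[rotated]) (auto simp: case_prod_unfold intro!: continuous_intros)
  then have "closed (?q ` ?E)" by (rule compact_imp_closed)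
  moreover have "?q ` ?E \<inter> unit_cone S = homogenize \<phi> -` D \<inter> unit_cone S"
    by (force simp: unit_cone_def homogenize_scaled)
  ultimately show "\<exists>A. closed A \<and> A \<inter> unit_cone S = homogenize \<phi> -` D \<inter> unit_cone S" by blast
qed

text \<open>The vertex x placed with full weight in copy 0 of the join. Rotating it \<kappa> times
  moves it to the copy of index \<kappa> modulo p.\<close>

definition vertex_loop :: "nat \<Rightarrow> 'a::real_normed_vector \<Rightarrow> int \<Rightarrow> real \<times> 'a" where
  "vertex_loop p x g = (if int p dvd g then (1, x) else 0)"

text \<open>\<open>\<kappa>\<close> colors the vertices. The weight of copy g is the total weight of
  its color class, and its point is the normalized average of that class; distinct colors use
  disjoint sets of vertices.\<close>

lemma orbit_simplex_vertex_loop: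
  fixes v :: "nat \<Rightarrow> 'a::real_normed_vector" and M p :: nat
  defines "b \<equiv> \<lambda>m. if m < M then vertex_loop p (v m) else (\<lambda>_. 0)"
    and "V \<equiv> \<lambda>\<kappa> g. {m. m < M \<and> int p dvd g - int (\<kappa> m)}"
  assumes "0 < M" "\<xi> \<in> orbit_simplex b M \<kappa>"
  obtains l x where "\<And>m. m < M \<Longrightarrow> 0 \<le> l m" "(\<Sum>m<M. l m) = 1"
    "\<And>g. \<xi> g = (\<Sum>m\<in>V \<kappa> g. l m, (\<Sum>m\<in>V \<kappa> g. l m) *\<^sub>R x g)"
    "\<And>g. x g \<in> convex hull (v ` {..<M})"
    "\<And>g. (\<Sum>m\<in>V \<kappa> g. l m) \<noteq> 0 \<Longrightarrow> x g \<in> convex hull (v ` V \<kappa> g)"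
proof -
  obtain l where l: "\<forall>m<M. 0 \<le> l m" "(\<Sum>m<M. l m) = 1"
    "\<forall>g. \<xi> g = (\<Sum>m<M. l m *\<^sub>R b m (g - int (\<kappa> m)))"
    using assms(4) by (auto simp: orbit_simplex_def)
  define t where "t g = (\<Sum>m\<in>V \<kappa> g. l m)" for g
  \<comment> \<open>At weight 0 the point is irrelevant for the join; \<open>v 0\<close> keeps it
    inside the simplex.\<close>
  define x where "x g = (if t g = 0 then v 0 else (\<Sum>m\<in>V \<kappa> g. (l m / t g) *\<^sub>R v m))" for g
  have fin: "finite (V \<kappa> g)" for g by (simp add: V_def)
  have \<xi>: "\<xi> g = (t g, \<Sum>m\<in>V \<kappa> g. l m *\<^sub>R v m)" for g
  proof -
    have "\<xi> g = (\<Sum>m\<in>V \<kappa> g. l m *\<^sub>R (1, v m))"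
      unfolding l(3)[rule_format] V_def
      by (rule sum.mono_neutral_cong_right) (auto simp: b_def vertex_loop_def)
    then show ?thesis by (simp add: t_def sum_prod)
  qed
  have hull: "x g \<in> convex hull (v ` V \<kappa> g)" if "t g \<noteq> 0" for g
  proof -
    have "(\<Sum>m\<in>V \<kappa> g. (l m / t g) *\<^sub>R v m) \<in> convex hull (v ` V \<kappa> g)"
    proof (rule convex_sum[OF fin convex_convex_hull])
      show "(\<Sum>m\<in>V \<kappa> g. l m / t g) = 1"
        using that by (simp add: t_def flip: sum_divide_distrib)
      have "0 \<le> t g" unfolding t_def using l(1) by (intro sum_nonneg) (auto simp: V_def)
      then show "0 \<le> l m / t g" if "m \<in> V \<kappa> g" for m using l(1) that by (auto simp: V_def)
    qed (auto intro: hull_inc)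
    then show ?thesis using that by (simp add: x_def)
  qed
  have scaled: "\<xi> g = (t g, t g *\<^sub>R x g)" for g
  proof (cases "t g = 0")
    case True
    then have "l m = 0" if "m \<in> V \<kappa> g" for m
      using l(1) fin that unfolding t_def by (subst (asm) sum_nonneg_eq_0_iff) (auto simp: V_def)
    then show ?thesis using True by (simp add: \<xi>)
  next
    case False
    then show ?thesis by (simp add: \<xi> x_def scaleR_sum_right)
  qed
  have "x g \<in> convex hull (v ` {..<M})" for g
  proof (cases "t g = 0")
    case True
    then show ?thesis using \<open>0 < M\<close> by (auto simp: x_def intro: hull_inc)
  next
    case False
    have "v ` V \<kappa> g \<subseteq> v ` {..<M}" by (auto simp: V_def)
    then show ?thesis using hull[OF False] hull_mono by blast
  qed
  with l(1,2) scaled hull show ?thesis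
    by (intro that[of l x]) (auto simp: t_def)
qed

text \<open>A shift of the index becomes a factor of the character; periodicity of \<open>H\<close>
  matches the term that leaves the range with the one that enters.\<close>

lemma character_sum_rotate:
  fixes H :: "int \<Rightarrow> complex"
  assumes "0 < p" and per: "\<And>g. H (g - int p) = H g"
  shows "(\<Sum>g<p. cis (2 * pi * real h * real g / real p) * H (int g - 1))
    = cis (2 * pi * real h / real p) * (\<Sum>g<p. cis (2 * pi * real h * real g / real p) * H (int g))"
proof -
  define u where "u k = cis (2 * pi * real h * of_int k / real p) * H k" for k :: int
  have "cis (2 * pi * real h * of_int (int p - 1) / real p) = cis (2 * pi * real h * of_int (-1) / real p)"
  proof -
    have "2 * pi * real h * of_int (int p - 1) / real p = 2 * pi * real h + 2 * pi * real h * of_int (-1) / real p"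
      using assms(1) by (simp add: field_simps)
    moreover have "cis (2 * pi * real h + y) = cis y" for y
      by (simp add: cis_multiple_2pi flip: cis_mult)
    ultimately show ?thesis by (simp only:)
  qed
  moreover have "H (int p - 1) = H (-1)" using per[of "int p - 1"] by simp
  ultimately have wrap: "u (int p - 1) = u (-1)" by (simp add: u_def)
  have "(\<Sum>g<p. cis (2 * pi * real h * real g / real p) * H (int g - 1))
      = (\<Sum>g<p. cis (2 * pi * real h / real p) * u (int g - 1))"
  proof (rule sum.cong)
    fix g
    have angle: "2 * pi * real h / real p + 2 * pi * real h * of_int (int g - 1) / real p
        = 2 * pi * real h * real g / real p"
      by (simp add: right_diff_distrib flip: add_divide_distrib)
    show "cis (2 * pi * real h * real g / real p) * H (int g - 1)
        = cis (2 * pi * real h / real p) * u (int g - 1)"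
      unfolding u_def mult.assoc[symmetric] cis_mult angle ..
  qed simp
  also have "\<dots> = cis (2 * pi * real h / real p) * (\<Sum>g<p. u (int g - 1))"
    by (simp add: sum_distrib_left)
  also have "(\<Sum>g<p. u (int g - 1)) = (\<Sum>g<p. u (int g))"
    using sum_lessThan_telescope[of "\<lambda>g. u (int g - 1)" p] wrap by (simp add: sum_subtractf)
  finally show ?thesis by (simp add: u_def)
qed

lemma uniformly_continuous_power_on_bounded:
  fixes R e :: real
  assumes "0 < e"
  obtains \<delta> where "0 < \<delta>"
    "\<And>z w :: complex. cmod z \<le> R \<Longrightarrow> cmod w \<le> R \<Longrightarrow> cmod (z - w) < \<delta> \<Longrightarrow> cmod (z ^ k - w ^ k) < e"
proof -
  have "uniformly_continuous_on (cball 0 R) (\<lambda>z::complex. z ^ k)"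
    by (intro compact_uniformly_continuous compact_cball continuous_intros)
  then show ?thesis
    using assms that unfolding uniformly_continuous_on_def
    by (metis dist_norm mem_cball_0)
qed

lemma finite_common_radius:
  fixes Q :: "'i \<Rightarrow> real \<Rightarrow> bool"
  assumes "finite I" "\<And>i. i \<in> I \<Longrightarrow> \<exists>\<delta>>0. Q i \<delta>" "\<And>i \<delta> \<delta>'. Q i \<delta> \<Longrightarrow> 0 < \<delta>' \<Longrightarrow> \<delta>' \<le> \<delta> \<Longrightarrow> Q i \<delta>'"
  shows "\<exists>\<delta>>0. \<forall>i\<in>I. Q i \<delta>"
proof -
  obtain d where d: "\<And>i. i \<in> I \<Longrightarrow> 0 < d i \<and> Q i (d i)" using assms(2) by metis
  have "0 < Min (insert 1 (d ` I))" using assms(1) d by auto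
  moreover have "Q i (Min (insert 1 (d ` I)))" if "i \<in> I" for i
    using assms(3)[of i "d i"] d[OF that] calculation assms(1) that by (auto simp: Min_le_iff)
  ultimately show ?thesis by blast
qed

text \<open>The deleted join of a simplex with 2n + 1 vertices is a join of 2n + 1 orbits of size p,
  one per vertex, where the orbit point is the color of the vertex. \<open>Zp_Borsuk_Ulam\<close> is
  applied to powers of the character sums.\<close>

theorem weighted_character_sums_vanish:
  fixes v :: "nat \<Rightarrow> 'a::real_normed_vector" and \<phi> :: "nat \<Rightarrow> 'a \<Rightarrow> complex" and h :: "nat \<Rightarrow> nat"
  assumes p: "2 \<le> p" and n: "1 \<le> n"
    and cont: "\<And>c. c < n \<Longrightarrow> continuous_on (convex hull (v ` {..<2 * n + 1})) (\<phi> c)"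
    and coprime: "\<And>c. c < n \<Longrightarrow> coprime (h c) p"
  obtains col :: "nat \<Rightarrow> nat" and t :: "nat \<Rightarrow> real" and x :: "nat \<Rightarrow> 'a"
  where "\<And>m. col m < p" "\<And>g. 0 \<le> t g" "(\<Sum>g<p. t g) = 1"
    "\<And>g. g < p \<Longrightarrow> t g \<noteq> 0 \<Longrightarrow> x g \<in> convex hull (v ` {m. m < 2 * n + 1 \<and> col m = g})"
    "\<And>c. c < n \<Longrightarrow> (\<Sum>g<p. cis (2 * pi * real (h c) * real g / real p) * (t g *\<^sub>R \<phi> c (x g))) = 0"
proof -
  define M where "M = 2 * n + 1"
  define S where "S = convex hull (v ` {..<M})"
  \<comment> \<open>The value 0 beyond M makes periodicity and the norm bound hold for every
    index.\<close>
  define b where "b m = (if m < M then vertex_loop p (v m) else (\<lambda>_. 0))" for m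
  define K where "K = orbit_simplex b M"
  have "0 < M" by (simp add: M_def)
  have "compact S" unfolding S_def by (intro finite_imp_compact_convex_hull) simp
  have per: "b m (g - int p) = b m g" for m g
    using dvd_add_triv_right_iff[of "int p" "g - int p"] by (simp add: b_def vertex_loop_def)
  have bounded: "norm (b m g) \<le> (\<Sum>m<M. norm (1::real, v m))" for m g
  proof (cases "m < M \<and> int p dvd g")
    case True
    then have "norm (b m g) = norm (1::real, v m)" by (simp add: b_def vertex_loop_def)
    also have "\<dots> \<le> (\<Sum>m<M. norm (1::real, v m))" by (rule member_le_sum) (use True in auto)
    finally show ?thesis .
  qed (auto simp: b_def vertex_loop_def intro: sum_nonneg)
  have K_per: "\<xi> (g - int p) = \<xi> g" if "\<xi> \<in> K \<kappa>" for \<xi> \<kappa> g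
  proof -
    have "b m (g - int p - k) = b m (g - k)" for m k
      using per[of m "g - k"] by (simp add: algebra_simps)
    then show ?thesis using that by (auto simp: K_def orbit_simplex_def)
  qed
  have K_cone: "\<xi> g \<in> unit_cone S" if "\<xi> \<in> K \<kappa>" for \<xi> \<kappa> g
  proof -
    from that have *: "\<xi> \<in> orbit_simplex (\<lambda>m. if m < M then vertex_loop p (v m) else (\<lambda>_. 0)) M \<kappa>"
      by (simp add: K_def b_def[abs_def])
    obtain l y where l: "\<And>m. m < M \<Longrightarrow> 0 \<le> l m" "(\<Sum>m<M. l m) = 1"
        "\<And>g. \<xi> g = (\<Sum>m | m < M \<and> int p dvd g - int (\<kappa> m). l m,
          (\<Sum>m | m < M \<and> int p dvd g - int (\<kappa> m). l m) *\<^sub>R y g)"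
        "\<And>g. y g \<in> convex hull (v ` {..<M})"
      by (rule orbit_simplex_vertex_loop[OF \<open>0 < M\<close> *]) blast
    define t where "t = (\<Sum>m | m < M \<and> int p dvd g - int (\<kappa> m). l m)"
    have "0 \<le> t" unfolding t_def using l(1) by (intro sum_nonneg) auto
    moreover have "t \<le> (\<Sum>m<M. l m)"
      unfolding t_def using l(1) by (intro sum_mono2) auto
    ultimately have "(t, y g) \<in> {0..1} \<times> S" using l(2,4) by (auto simp: S_def)
    moreover have "\<xi> g = (\<lambda>(t, x). (t, t *\<^sub>R x)) (t, y g)" using l(3)[of g] by (simp add: t_def)
    ultimately show ?thesis unfolding unit_cone_def by blast
  qed
  \<comment> \<open>The inverse k of h modulo p is the exponent that turns the character h into the
    standard one. It is nonzero, so the power has the same zeros as the sum.\<close>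
  have "\<exists>k. [h c * k = 1] (mod p)" if "c < n" for c
    using cong_solve_coprime_nat[OF coprime[OF that]] by simp
  then obtain k where k: "\<And>c. c < n \<Longrightarrow> [h c * k c = 1] (mod p)" by metis
  define \<psi> where "\<psi> c \<xi> = (\<Sum>g<p. cis (2 * pi * real (h c) * real g / real p) * homogenize (\<phi> c) (\<xi> (int g)))"
    for c and \<xi> :: "int \<Rightarrow> real \<times> 'a"
  define F where "F \<xi> c = \<psi> c \<xi> ^ k c" for \<xi> c

  have \<psi>_rot: "\<psi> c (rotate_index \<xi>) = cis (2 * pi * real (h c) / real p) * \<psi> c \<xi>"
    if "\<xi> \<in> K \<kappa>" for \<xi> \<kappa> c
    unfolding \<psi>_def rotate_index_def
    by (rule character_sum_rotate) (use p K_per[OF that] in auto)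
  have equiv: "F (rotate_index \<xi>) c = cis (2 * pi / real p) * F \<xi> c" if "\<xi> \<in> K \<kappa>" "c < n" for \<xi> \<kappa> c
  proof -
    have "1 \<le> h c * k c" using k[OF that(2)] p by (cases "h c * k c") (auto simp: cong_def)
    then obtain q where q: "h c * k c = q * p + 1" using k[OF \<open>c < n\<close>] cong_le_nat by blast
    have "real (k c) * (2 * pi * real (h c) / real p) = 2 * pi * real (h c * k c) / real p"
      by simp
    also have "\<dots> = 2 * pi / real p + 2 * pi * real q"
      unfolding q using p by (simp add: field_simps)
    finally have "real (k c) * (2 * pi * real (h c) / real p) = 2 * pi / real p + 2 * pi * real q" .
    then have "cis (2 * pi * real (h c) / real p) ^ k c = cis (2 * pi / real p) * cis (2 * pi * real q)"
      by (simp only: Complex.DeMoivre cis_mult)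
    then show ?thesis
      by (simp add: F_def \<psi>_rot[OF that(1)] power_mult_distrib cis_multiple_2pi)
  qed
  have ucont_one: "\<exists>\<delta>>0. \<forall>\<kappa> \<kappa>'. \<forall>\<xi>\<in>K \<kappa>. \<forall>\<xi>'\<in>K \<kappa>'.
      (\<forall>g. norm (\<xi> g - \<xi>' g) < \<delta>) \<longrightarrow> cmod (F \<xi> c - F \<xi>' c) < e" if c: "c < n" and "0 < e" for c e
  proof -
    let ?H = "homogenize (\<phi> c)"
    have contH: "continuous_on (unit_cone S) ?H"
      using cont[OF c] \<open>compact S\<close> by (intro continuous_on_homogenize) (simp_all add: S_def M_def)
    have "bounded (?H ` unit_cone S)"
      by (intro compact_imp_bounded compact_continuous_image contH compact_unit_cone \<open>compact S\<close>)
    then obtain R where R: "\<And>z. z \<in> unit_cone S \<Longrightarrow> cmod (?H z) \<le> R" by (auto simp: bounded_iff)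
    have bound: "cmod (\<psi> c \<xi>) \<le> real p * R" if "\<xi> \<in> K \<kappa>" for \<xi> \<kappa>
      unfolding \<psi>_def
      by (rule order_trans[OF norm_sum order_trans[OF sum_bounded_above[where K = R]]])
        (auto simp: norm_mult intro: R K_cone[OF that])
    obtain \<delta>1 where \<delta>1: "0 < \<delta>1" "\<And>z w. cmod z \<le> real p * R \<Longrightarrow> cmod w \<le> real p * R \<Longrightarrow>
        cmod (z - w) < \<delta>1 \<Longrightarrow> cmod (z ^ k c - w ^ k c) < e"
      using uniformly_continuous_power_on_bounded[OF \<open>0 < e\<close>] by metis
    have "uniformly_continuous_on (unit_cone S) ?H"
      by (intro compact_uniformly_continuous contH compact_unit_cone \<open>compact S\<close>)
    moreover have "0 < \<delta>1 / real p" using \<delta>1(1) p by simp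
    ultimately obtain \<delta> where \<delta>: "0 < \<delta>" "\<And>z w. z \<in> unit_cone S \<Longrightarrow> w \<in> unit_cone S \<Longrightarrow> norm (z - w) < \<delta> \<Longrightarrow>
        cmod (?H z - ?H w) < \<delta>1 / real p"
      unfolding uniformly_continuous_on_def dist_norm by blast
    have "cmod (F \<xi> c - F \<xi>' c) < e"
      if \<xi>: "\<xi> \<in> K \<kappa>" "\<xi>' \<in> K \<kappa>'" and close: "\<forall>g. norm (\<xi> g - \<xi>' g) < \<delta>" for \<xi> \<xi>' \<kappa> \<kappa>'
    proof -
      have "cmod (\<psi> c \<xi> - \<psi> c \<xi>') \<le> (\<Sum>g<p. cmod (?H (\<xi> (int g)) - ?H (\<xi>' (int g))))"
        unfolding \<psi>_def sum_subtractf[symmetric] right_diff_distrib[symmetric]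
        by (rule order_trans[OF norm_sum]) (simp add: norm_mult)
      also have "\<dots> < (\<Sum>g<p. \<delta>1 / real p)"
        by (rule sum_strict_mono) (use p \<xi> close in \<open>auto intro!: \<delta>(2) K_cone simp: lessThan_empty_iff\<close>)
      also have "\<dots> = \<delta>1" using p by simp
      finally show ?thesis unfolding F_def by (intro \<delta>1(2) bound[OF \<xi>(1)] bound[OF \<xi>(2)])
    qed
    then show ?thesis using \<delta>(1) by blast
  qed
  have ucont: "\<exists>\<delta>>0. \<forall>\<kappa> \<kappa>'. \<forall>\<xi>\<in>K \<kappa>. \<forall>\<xi>'\<in>K \<kappa>'.
      (\<forall>g. norm (\<xi> g - \<xi>' g) < \<delta>) \<longrightarrow> (\<forall>c<n. cmod (F \<xi> c - F \<xi>' c) < e)" if "0 < e" for e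
  proof -
    have "\<exists>\<delta>>0. \<forall>c\<in>{..<n}. \<forall>\<kappa> \<kappa>'. \<forall>\<xi>\<in>K \<kappa>. \<forall>\<xi>'\<in>K \<kappa>'.
      (\<forall>g. norm (\<xi> g - \<xi>' g) < \<delta>) \<longrightarrow> cmod (F \<xi> c - F \<xi>' c) < e"
    proof (rule finite_common_radius)
      fix c \<delta> \<delta>' assume "\<forall>\<kappa> \<kappa>'. \<forall>\<xi>\<in>K \<kappa>. \<forall>\<xi>'\<in>K \<kappa>'.
        (\<forall>g. norm (\<xi> g - \<xi>' g) < \<delta>) \<longrightarrow> cmod (F \<xi> c - F \<xi>' c) < e" and "\<delta>' \<le> (\<delta>::real)"
      then show "\<forall>\<kappa> \<kappa>'. \<forall>\<xi>\<in>K \<kappa>. \<forall>\<xi>'\<in>K \<kappa>'.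
        (\<forall>g. norm (\<xi> g - \<xi>' g) < \<delta>') \<longrightarrow> cmod (F \<xi> c - F \<xi>' c) < e"
        by (meson order_less_le_trans)
    qed (use ucont_one that in auto)
    then show ?thesis by blast
  qed
  have "\<exists>\<kappa>. \<exists>\<xi>\<in>orbit_simplex b (2 * n + 1) \<kappa>. \<forall>c<n. F \<xi> c = 0"
    by (rule Zp_Borsuk_Ulam[OF p n])
      (fact per bounded equiv[unfolded K_def M_def] ucont[unfolded K_def M_def])+
  then obtain \<kappa> \<xi> where \<xi>: "\<xi> \<in> K \<kappa>" "\<And>c. c < n \<Longrightarrow> F \<xi> c = 0"
    unfolding K_def M_def by blast
  define V where "V g = {m. m < M \<and> int p dvd g - int (\<kappa> m)}" for g
  from \<xi>(1) have *: "\<xi> \<in> orbit_simplex (\<lambda>m. if m < M then vertex_loop p (v m) else (\<lambda>_. 0)) M \<kappa>"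
    by (simp add: K_def b_def[abs_def])
  obtain l y where l: "\<And>m. m < M \<Longrightarrow> 0 \<le> l m" "(\<Sum>m<M. l m) = 1"
      "\<And>g. \<xi> g = (\<Sum>m\<in>V g. l m, (\<Sum>m\<in>V g. l m) *\<^sub>R y g)"
      "\<And>g. (\<Sum>m\<in>V g. l m) \<noteq> 0 \<Longrightarrow> y g \<in> convex hull (v ` V g)"
    unfolding V_def by (rule orbit_simplex_vertex_loop[OF \<open>0 < M\<close> *]) blast
  have V_col: "V (int g) = {m. m < M \<and> \<kappa> m mod p = g}" if "g < p" for g
  proof -
    have "int p dvd int g - int (\<kappa> m) \<longleftrightarrow> \<kappa> m mod p = g" for m
      using that by (metis cong_def cong_iff_dvd_diff cong_int_iff mod_less)
    then show ?thesis by (simp add: V_def)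
  qed
  show ?thesis
  proof (rule that[of "\<lambda>m. \<kappa> m mod p" "\<lambda>g. \<Sum>m\<in>V (int g). l m" "\<lambda>g. y (int g)"])
    show "\<kappa> m mod p < p" for m using p by simp
    show "0 \<le> (\<Sum>m\<in>V (int g). l m)" for g using l(1) by (intro sum_nonneg) (auto simp: V_def)
    have "(\<Sum>g<p. \<Sum>m\<in>V (int g). l m) = (\<Sum>g<p. \<Sum>m | m \<in> {..<M} \<and> \<kappa> m mod p = g. l m)"
      by (rule sum.cong) (auto simp: V_col)
    also have "\<dots> = (\<Sum>m<M. l m)" by (rule sum.group) (use p in auto)
    finally show "(\<Sum>g<p. \<Sum>m\<in>V (int g). l m) = 1" using l(2) by simp
    show "y (int g) \<in> convex hull (v ` {m. m < 2 * n + 1 \<and> \<kappa> m mod p = g})"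
      if "g < p" "(\<Sum>m\<in>V (int g). l m) \<noteq> 0" for g
      using l(4)[OF that(2)] V_col[OF that(1)] by (simp add: M_def)
    show "(\<Sum>g<p. cis (2 * pi * real (h c) * real g / real p) * ((\<Sum>m\<in>V (int g). l m) *\<^sub>R \<phi> c (y (int g)))) = 0"
      if "c < n" for c
    proof -
      have "k c \<noteq> 0" using k[OF that] p by (cases "k c = 0") (auto simp: cong_def)
      then have "\<psi> c \<xi> = 0" using \<xi>(2)[OF that] by (simp add: F_def)
      then show ?thesis unfolding \<psi>_def l(3) homogenize_scaled .
    qed
  qed
qed

section \<open>Fourier inversion and regular polygons\<close>

lemma cis_root_of_unity_neq_1:
  assumes "0 < \<bar>k\<bar>" "\<bar>k\<bar> < int r"
  shows "cis (2 * pi * of_int k / real r) \<noteq> 1"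
proof
  assume "cis (2 * pi * of_int k / real r) = 1"
  then have "cos (2 * pi * of_int k / real r) = 1" by (metis cis.simps(1) one_complex.simps(1))
  then obtain j :: int where j: "2 * pi * of_int k / real r = of_int j * 2 * pi"
    using cos_one_2pi_int by auto
  have "(of_int k :: real) = of_int (j * int r)"
    using j assms by (simp add: field_simps)
  then have k: "k = j * int r" by (simp only: of_int_eq_iff)
  then have "\<bar>j\<bar> \<ge> 1" using assms(1) by auto
  then have "int r \<le> \<bar>j\<bar> * int r" by (simp add: mult_le_cancel_right1)
  then show False using k assms(2) by (simp add: abs_mult)
qed

lemma sum_character:
  assumes "\<bar>k\<bar> < int r"
  shows "(\<Sum>h<r. cis (2 * pi * of_int k * real h / real r)) = (if k = 0 then of_nat r else 0)"
proof (cases "k = 0")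
  case False
  let ?z = "cis (2 * pi * of_int k / real r)"
  have r: "0 < r" using assms by auto
  have "(\<Sum>h<r. cis (2 * pi * of_int k * real h / real r)) = (\<Sum>h<r. ?z ^ h)"
    by (intro sum.cong refl) (simp add: Complex.DeMoivre mult_ac)
  moreover have "(\<Sum>h<r. ?z ^ h) = (?z ^ r - 1) / (?z - 1)"
    by (rule geometric_sum) (use cis_root_of_unity_neq_1 False assms in auto)
  moreover have "?z ^ r = 1" using r by (simp add: Complex.DeMoivre)
  ultimately show ?thesis using False by simp
qed simp

lemma character_sum_inversion:
  fixes \<psi> :: "nat \<Rightarrow> complex"
  assumes "g < r"
  shows "of_nat r * \<psi> g = (\<Sum>h<r. cis (- (2 * pi * real h * real g / real r)) *
    (\<Sum>g'<r. cis (2 * pi * real h * real g' / real r) * \<psi> g'))"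
proof -
  have "(\<Sum>h<r. cis (- (2 * pi * real h * real g / real r)) *
      (\<Sum>g'<r. cis (2 * pi * real h * real g' / real r) * \<psi> g'))
    = (\<Sum>h<r. \<Sum>g'<r. cis (2 * pi * of_int (int g' - int g) * real h / real r) * \<psi> g')"
    unfolding sum_distrib_left
  proof (intro sum.cong refl)
    fix h g'
    have "- (2 * pi * real h * real g / real r) + 2 * pi * real h * real g' / real r
        = 2 * pi * of_int (int g' - int g) * real h / real r"
      by (simp add: diff_divide_distrib algebra_simps)
    then show "cis (- (2 * pi * real h * real g / real r)) * (cis (2 * pi * real h * real g' / real r) * \<psi> g')
        = cis (2 * pi * of_int (int g' - int g) * real h / real r) * \<psi> g'"
      by (simp only: mult.assoc[symmetric] cis_mult)
  qed
  also have "\<dots> = (\<Sum>g'<r. (\<Sum>h<r. cis (2 * pi * of_int (int g' - int g) * real h / real r)) * \<psi> g')"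
    by (subst sum.swap) (simp only: sum_distrib_right)
  also have "\<dots> = (\<Sum>g'<r. (if g' = g then of_nat r else 0) * \<psi> g')"
    by (intro sum.cong refl arg_cong2[where f = "(*)"], subst sum_character) (use assms in auto)
  also have "\<dots> = of_nat r * \<psi> g" using assms by (simp add: if_distrib[of "\<lambda>x. x * _"] cong: if_cong)
  finally show ?thesis ..
qed

lemma constant_of_character_sums:
  fixes \<psi> :: "nat \<Rightarrow> complex"
  assumes "\<And>h. 0 < h \<Longrightarrow> h < r \<Longrightarrow> (\<Sum>g<r. cis (2 * pi * real h * real g / real r) * \<psi> g) = 0"
    and "g < r"
  shows "of_nat r * \<psi> g = (\<Sum>g<r. \<psi> g)"
proof -
  have "of_nat r * \<psi> g = (\<Sum>h<r. if h = 0 then \<Sum>g<r. \<psi> g else 0)"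
    unfolding character_sum_inversion[OF assms(2)]
    by (intro sum.cong refl) (use assms(1) in auto)
  then show ?thesis using assms(2) by simp
qed

text \<open>In the inversion formula only the frequencies 0 and r - 1 survive, and the conjugate of
  the character r - 1 is the character 1.\<close>

lemma affine_of_character_sums:
  fixes \<psi> :: "nat \<Rightarrow> complex"
  assumes "2 \<le> r"
    and "\<And>h. 0 < h \<Longrightarrow> h < r - 1 \<Longrightarrow> (\<Sum>g<r. cis (2 * pi * real h * real g / real r) * \<psi> g) = 0"
  obtains A B where "\<And>g. g < r \<Longrightarrow> \<psi> g = A + B * cis (2 * pi * real g / real r)"
proof -
  define A where "A = (\<Sum>g<r. \<psi> g) / of_nat r"
  define B where "B = (\<Sum>g<r. cis (2 * pi * real (r - 1) * real g / real r) * \<psi> g) / of_nat r"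
  have "\<psi> g = A + B * cis (2 * pi * real g / real r)" if "g < r" for g
  proof -
    have "of_nat r * \<psi> g = (\<Sum>h\<in>{0, r - 1}. cis (- (2 * pi * real h * real g / real r)) *
      (\<Sum>g'<r. cis (2 * pi * real h * real g' / real r) * \<psi> g'))"
      unfolding character_sum_inversion[OF that]
    proof (rule sum.mono_neutral_right)
      show "\<forall>h\<in>{..<r} - {0, r - 1}. cis (- (2 * pi * real h * real g / real r)) *
        (\<Sum>g'<r. cis (2 * pi * real h * real g' / real r) * \<psi> g') = 0"
      proof
        fix h assume "h \<in> {..<r} - {0, r - 1}"
        then have "0 < h" "h < r - 1" by auto
        then show "cis (- (2 * pi * real h * real g / real r)) *
          (\<Sum>g'<r. cis (2 * pi * real h * real g' / real r) * \<psi> g') = 0"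
          by (simp only: assms(2) mult_zero_right)
      qed
    qed (use assms(1) in auto)
    also have "\<dots> = of_nat r * A + cis (- (2 * pi * real (r - 1) * real g / real r)) * (of_nat r * B)"
      using assms(1) by (simp add: A_def B_def)
    also have "cis (- (2 * pi * real (r - 1) * real g / real r)) = cis (2 * pi * real g / real r)"
    proof -
      have "2 * pi * real g / real r = - (2 * pi * real (r - 1) * real g / real r) + 2 * pi * real g"
        using assms(1) by (simp add: of_nat_diff field_simps)
      then show ?thesis by (simp only: cis_mult[symmetric]) simp
    qed
    finally have "of_nat r * \<psi> g = of_nat r * (A + B * cis (2 * pi * real g / real r))"
      by (simp add: algebra_simps)
    then show ?thesis using assms(1) by simp
  qed
  then show ?thesis by (rule that)
qed

section \<open>Real coordinates paired into complex ones\<close>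

lemma sum_lessThan_double:
  fixes g :: "nat \<Rightarrow> 'b::comm_monoid_add"
  shows "(\<Sum>m<2 * a. g m) = (\<Sum>j<a. g (2 * j) + g (2 * j + 1))"
  by (induction a) (auto simp: add_ac)

lemma inner_vec_bij:
  fixes p :: "nat \<Rightarrow> 'd::finite" and u w :: "real ^ 'd"
  assumes "bij_betw p {..<2 * a} UNIV"
  shows "u \<bullet> w = (\<Sum>j<a. u $ p (2 * j) * w $ p (2 * j) + u $ p (2 * j + 1) * w $ p (2 * j + 1))"
proof -
  have "u \<bullet> w = (\<Sum>m<2 * a. u $ p m * w $ p m)"
    unfolding inner_vec_def inner_real_def by (rule sum.reindex_bij_betw[OF assms, symmetric])
  then show ?thesis by (simp add: sum_lessThan_double)
qed

lemma vec_eq_bij: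
  fixes p :: "nat \<Rightarrow> 'd::finite" and u w :: "real ^ 'd"
  assumes "bij_betw p {..<2 * a} UNIV"
    and "\<And>j. j < a \<Longrightarrow> u $ p (2 * j) = w $ p (2 * j) \<and> u $ p (2 * j + 1) = w $ p (2 * j + 1)"
  shows "u = w"
proof -
  have "(u - w) \<bullet> (u - w) = 0" unfolding inner_vec_bij[OF assms(1)]
    by (intro sum.neutral ballI) (use assms(2) in auto)
  then show ?thesis by simp
qed

definition realify :: "(nat \<Rightarrow> 'd::finite) \<Rightarrow> nat \<Rightarrow> (nat \<Rightarrow> complex) \<Rightarrow> real ^ 'd" where
  "realify p a z = (\<chi> i. let m = inv_into {..<2 * a} p i in
    if even m then Re (z (m div 2)) else Im (z (m div 2)))"

lemma realify_nth:
  assumes "bij_betw p {..<2 * a} UNIV" "j < a"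
  shows "realify p a z $ p (2 * j) = Re (z j)" "realify p a z $ p (2 * j + 1) = Im (z j)"
proof -
  have "inv_into {..<2 * a} p (p m) = m" if "m < 2 * a" for m
    using assms(1) that by (simp add: bij_betw_inv_into_left)
  then show "realify p a z $ p (2 * j) = Re (z j)" "realify p a z $ p (2 * j + 1) = Im (z j)"
    using assms(2) by (auto simp: realify_def Let_def)
qed

text \<open>In complex coordinates the points are A plus B rotated by roots of unity. The vectors B
  and \<open>\<i>\<close> B are orthogonal and of equal length for the real inner product, so they
  span the plane of the polygon.\<close>

lemma regular_polygon_of_character:
  fixes p :: "nat \<Rightarrow> 'd::finite" and y :: "nat \<Rightarrow> real ^ 'd"
  assumes bij: "bij_betw p {..<2 * a} UNIV" and r: "3 \<le> r" and "j0 < a" "B j0 \<noteq> 0"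
    and y: "\<And>g j. g < r \<Longrightarrow> j < a \<Longrightarrow>
      Complex (y g $ p (2 * j)) (y g $ p (2 * j + 1)) = A j + B j * cis (2 * pi * real g / real r)"
  shows "regular_polygon_vertices r (y ` {..<r})"
proof -
  define u where "u = realify p a B"
  define v where "v = realify p a (\<lambda>j. \<i> * B j)"
  define \<rho> where "\<rho> = norm u"
  note nth = realify_nth[OF bij]
  have sq: "(cmod z)\<^sup>2 = Re z * Re z + Im z * Im z" for z
    by (simp only: cmod_power2) (simp only: power2_eq_square)
  have "u \<bullet> u = (\<Sum>j<a. (cmod (B j))\<^sup>2)"
    unfolding inner_vec_bij[OF bij] u_def sq
    by (intro sum.cong refl) (use nth in auto)
  moreover have "v \<bullet> v = (\<Sum>j<a. (cmod (B j))\<^sup>2)"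
    unfolding inner_vec_bij[OF bij] v_def sq
    by (intro sum.cong refl) (use nth in auto)
  moreover have "0 < (\<Sum>j<a. (cmod (B j))\<^sup>2)"
    by (rule sum_pos2[of _ j0]) (use assms(3,4) in auto)
  ultimately have norms: "norm v = \<rho>" "0 < \<rho>" by (auto simp: \<rho>_def norm_eq_sqrt_inner)
  have "u \<bullet> v = (\<Sum>j<a. 0)"
    unfolding inner_vec_bij[OF bij] u_def v_def
    by (intro sum.cong refl) (use nth in auto)
  then have orth: "orthogonal u v" by (simp add: orthogonal_def)
  have "y g = realify p a A + \<rho> *\<^sub>R (cos (2 * pi * real g / real r) *\<^sub>R (u /\<^sub>R \<rho>)
      + sin (2 * pi * real g / real r) *\<^sub>R (v /\<^sub>R \<rho>))" if "g < r" for g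
  proof -
    have "y g = realify p a A + (cos (2 * pi * real g / real r) *\<^sub>R u + sin (2 * pi * real g / real r) *\<^sub>R v)"
    proof (rule vec_eq_bij[OF bij])
      fix j assume j: "j < a"
      show "y g $ p (2 * j) = (realify p a A + (cos (2 * pi * real g / real r) *\<^sub>R u
            + sin (2 * pi * real g / real r) *\<^sub>R v)) $ p (2 * j)
          \<and> y g $ p (2 * j + 1) = (realify p a A + (cos (2 * pi * real g / real r) *\<^sub>R u
            + sin (2 * pi * real g / real r) *\<^sub>R v)) $ p (2 * j + 1)"
        using y[OF that j] nth[OF j] by (simp add: complex_eq_iff u_def v_def mult_ac)
    qed
    moreover have "\<rho> *\<^sub>R (s *\<^sub>R (w /\<^sub>R \<rho>)) = s *\<^sub>R w" for s and w :: "real ^ 'd"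
      using norms(2) by (simp add: field_simps)
    ultimately show ?thesis by (simp only: scaleR_add_right)
  qed
  then have "y ` {..<r} = (\<lambda>j. realify p a A + \<rho> *\<^sub>R (cos (2 * pi * real j / real r) *\<^sub>R (u /\<^sub>R \<rho>)
      + sin (2 * pi * real j / real r) *\<^sub>R (v /\<^sub>R \<rho>))) ` {..<r}"
    by (intro image_cong) auto
  moreover have "norm (u /\<^sub>R \<rho>) = 1" "norm (v /\<^sub>R \<rho>) = 1" "orthogonal (u /\<^sub>R \<rho>) (v /\<^sub>R \<rho>)"
    using norms orth by (auto simp: \<rho>_def orthogonal_def)
  ultimately show ?thesis unfolding regular_polygon_vertices_def using r norms(2) by blast
qed

section \<open>Fourier genericity for a single cyclic group\<close>

lemma span_axis_pair:
  fixes s t :: "'d::finite"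
  shows "span {axis s 1, axis t (1::real)} = {x *\<^sub>R axis s 1 + y *\<^sub>R axis t 1 | x y. True}"
proof -
  have "v \<in> span {axis s 1, axis t (1::real)} \<longleftrightarrow> (\<exists>x y. v = x *\<^sub>R axis s 1 + y *\<^sub>R axis t 1)" for v
    unfolding span_breakdown_eq span_empty by (auto simp: algebra_simps)
  then show ?thesis by auto
qed

lemma coordinate_planes_decomposition:
  fixes p :: "nat \<Rightarrow> 'd::finite" and L :: "nat \<Rightarrow> (real ^ 'd) set"
  assumes bij: "bij_betw p {..<2 * a} UNIV" and a: "1 \<le> a"
  shows "coordinate_decomposition a 0 (\<lambda>i. span {axis (p (2 * i)) 1, axis (p (2 * i + 1)) 1}) L"
proof -
  let ?U = "\<lambda>i. span {axis (p (2 * i)) 1, axis (p (2 * i + 1)) (1::real)}"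
  have eq_iff: "p m = p m' \<longleftrightarrow> m = m'" if "m < 2 * a" "m' < 2 * a" for m m'
    using bij that unfolding bij_betw_def inj_on_def by auto
  have card: "CARD('d) = 2 * a" using bij_betw_same_card[OF bij] by simp
  have plane: "coordinate_plane (?U i)" if "i < a" for i
    unfolding coordinate_plane_def
    by (intro exI[of _ "p (2 * i)"] exI[of _ "p (2 * i + 1)"])
      (use eq_iff[of "2 * i" "2 * i + 1"] that in simp)
  have orth: "orthogonal u v" if ii: "i < a" "i' < a" "i \<noteq> i'" and u: "u \<in> ?U i" and v: "v \<in> ?U i'" for i i' u v
  proof -
    have ip: "axis (p m) 1 \<bullet> axis (p m') (1::real) = 0" if "m < 2 * a" "m' < 2 * a" "m \<noteq> m'" for m m'
      using eq_iff that by (simp add: inner_axis_axis)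
    obtain x y where u_eq: "u = x *\<^sub>R axis (p (2 * i)) 1 + y *\<^sub>R axis (p (2 * i + 1)) 1"
      using u unfolding span_axis_pair by blast
    obtain x' y' where v_eq: "v = x' *\<^sub>R axis (p (2 * i')) 1 + y' *\<^sub>R axis (p (2 * i' + 1)) 1"
      using v unfolding span_axis_pair by blast
    have "2 * i < 2 * a" "2 * i + 1 < 2 * a" "2 * i' < 2 * a" "2 * i' + 1 < 2 * a"
      "2 * i \<noteq> 2 * i'" "2 * i \<noteq> 2 * i' + 1" "2 * i + 1 \<noteq> 2 * i'" "2 * i + 1 \<noteq> 2 * i' + 1"
      using ii by presburger+
    note bounds = this
    have "axis (p (2 * i)) 1 \<bullet> axis (p (2 * i')) (1::real) = 0"
      "axis (p (2 * i)) 1 \<bullet> axis (p (2 * i' + 1)) (1::real) = 0"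
      "axis (p (2 * i + 1)) 1 \<bullet> axis (p (2 * i')) (1::real) = 0"
      "axis (p (2 * i + 1)) 1 \<bullet> axis (p (2 * i' + 1)) (1::real) = 0"
      by (intro ip bounds)+
    then show ?thesis
      unfolding u_eq v_eq orthogonal_def by (simp add: inner_add_left inner_add_right)
  qed
  have "axis k 1 \<in> (\<Union>i<a. ?U i)" for k :: 'd
  proof -
    obtain m where m: "m < 2 * a" "k = p m" using bij unfolding bij_betw_def by blast
    have "axis (p m) 1 \<in> {axis (p (2 * (m div 2))) 1, axis (p (2 * (m div 2) + 1)) (1::real)}"
      by (cases "even m") simp_all
    then have "axis k 1 \<in> ?U (m div 2)" unfolding m(2) by (rule span_base)
    moreover have "m div 2 < a" using m(1) by simp
    ultimately show ?thesis by blast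
  qed
  then have "Basis \<subseteq> (\<Union>i<a. ?U i)" by (auto simp: Basis_vec_def)
  then have "span ((\<Union>i<a. ?U i) \<union> (\<Union>j<0. L j)) = UNIV"
    using span_mono[of Basis "(\<Union>i<a. ?U i) \<union> (\<Union>j<0. L j)"] by auto
  then show ?thesis
    unfolding coordinate_decomposition_def
    by (intro conjI allI impI ballI) (use card a plane orth in \<open>simp_all del: One_nat_def\<close>)
qed

definition complex_coordinates :: "(nat \<Rightarrow> 'd::finite) \<Rightarrow> nat \<Rightarrow> real ^ 'd \<Rightarrow> nat \<Rightarrow> complex" where
  "complex_coordinates p a v i =
    (if i < a then Complex (v $ p (2 * i)) (v $ p (2 * i + 1)) else 0)"

lemma complex_coordinates_permutation:
  assumes "bij_betw p {..<2 * a} UNIV"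
  shows "coordinate_permutation a 0 (complex_coordinates p a)"
  unfolding coordinate_permutation_def
  by (rule exI[of _ p]) (use assms in \<open>auto simp: complex_coordinates_def\<close>)

lemma complex_coordinates_plane:
  fixes p :: "nat \<Rightarrow> 'd::finite"
  assumes bij: "bij_betw p {..<2 * a} UNIV" and i: "i < a"
  shows "complex_coordinates p a ` span {axis (p (2 * i)) 1, axis (p (2 * i + 1)) 1} = coordinate_axis a 0 i"
proof -
  have eq_iff: "p m = p m' \<longleftrightarrow> m = m'" if "m < 2 * a" "m' < 2 * a" for m m'
    using bij that unfolding bij_betw_def inj_on_def by auto
  have coords: "complex_coordinates p a (x *\<^sub>R axis (p (2 * i)) 1 + y *\<^sub>R axis (p (2 * i + 1)) 1)
      = (\<lambda>j. if j = i then Complex x y else 0)" for x y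
  proof
    fix j
    have "2 * i \<noteq> Suc (2 * j)" "Suc (2 * i) \<noteq> 2 * j" by presburger+
    then show "complex_coordinates p a (x *\<^sub>R axis (p (2 * i)) 1 + y *\<^sub>R axis (p (2 * i + 1)) 1) j
        = (if j = i then Complex x y else 0)"
      using i eq_iff[of "2 * i" "2 * j"] eq_iff[of "2 * i" "2 * j + 1"]
        eq_iff[of "2 * i + 1" "2 * j"] eq_iff[of "2 * i + 1" "2 * j + 1"]
      by (auto simp: complex_coordinates_def axis_def complex_eq_iff)
  qed
  show ?thesis
  proof (intro equalityI subsetI)
    fix w assume "w \<in> complex_coordinates p a ` span {axis (p (2 * i)) 1, axis (p (2 * i + 1)) 1}"
    then obtain x y where "w = complex_coordinates p a (x *\<^sub>R axis (p (2 * i)) 1 + y *\<^sub>R axis (p (2 * i + 1)) 1)"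
      unfolding span_axis_pair by blast
    then show "w \<in> coordinate_axis a 0 i"
      unfolding coords using i by (auto simp: coordinate_axis_def complex_real_space_def)
  next
    fix w assume "w \<in> coordinate_axis a 0 i"
    then have "w = (\<lambda>j. if j = i then Complex (Re (w i)) (Im (w i)) else 0)"
      by (auto simp: coordinate_axis_def)
    then have "w = complex_coordinates p a (Re (w i) *\<^sub>R axis (p (2 * i)) 1 + Im (w i) *\<^sub>R axis (p (2 * i + 1)) 1)"
      unfolding coords .
    then show "w \<in> complex_coordinates p a ` span {axis (p (2 * i)) 1, axis (p (2 * i + 1)) 1}"
      unfolding span_axis_pair by blast
  qed
qed

section \<open>Characters of a single cyclic group\<close>

lemma cyclic_sum_one_carrier:
  assumes "0 < r"
  shows "bij_betw (\<lambda>s. \<lambda>i\<in>{..<1}. int s) {..<r} (carrier (cyclic_sum 1 (\<lambda>_. r)))"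
proof (rule bij_betw_byWitness[where f' = "\<lambda>g. nat (g 0)"])
  have carrier: "carrier (cyclic_sum 1 (\<lambda>_. r)) = (\<Pi>\<^sub>E i\<in>{..<1}. {0..<int r})"
    using assms by (simp add: cyclic_sum_def carrier_integer_mod_group)
  show "\<forall>g\<in>carrier (cyclic_sum 1 (\<lambda>_. r)). (\<lambda>i\<in>{..<1}. int (nat (g 0))) = g"
  proof
    fix g assume g: "g \<in> carrier (cyclic_sum 1 (\<lambda>_. r))"
    then have "g 0 \<in> {0..<int r}" and "g \<in> extensional {..<1}" unfolding carrier by (auto simp: PiE_iff)
    then show "(\<lambda>i\<in>{..<1}. int (nat (g 0))) = g"
      by (intro ext) (auto simp: restrict_def extensional_def)
  qed
  show "(\<lambda>s. \<lambda>i\<in>{..<1}. int s) ` {..<r} \<subseteq> carrier (cyclic_sum 1 (\<lambda>_. r))"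
    unfolding carrier by (simp only: image_subset_iff restrict_PiE_iff) auto
  show "(\<lambda>g. nat (g 0)) ` carrier (cyclic_sum 1 (\<lambda>_. r)) \<subseteq> {..<r}"
  proof (rule image_subsetI)
    fix g assume "g \<in> carrier (cyclic_sum 1 (\<lambda>_. r))"
    then have "g 0 \<in> {0..<int r}" unfolding carrier by (auto simp: PiE_iff)
    then show "nat (g 0) \<in> {..<r}" using assms by auto
  qed
qed auto

lemma fourier_coefficient_constant:
  assumes h: "h \<in> carrier (cyclic_sum 1 (\<lambda>_. r)) - {\<one>\<^bsub>cyclic_sum 1 (\<lambda>_. r)\<^esub>}" and r: "0 < r"
    and y: "\<And>s. s < r \<Longrightarrow> y (\<lambda>i\<in>{..<1}. int s) = A"
  shows "fourier_coefficient 1 (\<lambda>_. r) y h = 0"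
proof -
  let ?G = "cyclic_sum 1 (\<lambda>_. r)"
  obtain s0 where s0: "s0 < r" "h = (\<lambda>i\<in>{..<1}. int s0)"
    using h bij_betw_imp_surj_on[OF cyclic_sum_one_carrier[OF r]] by blast
  have "s0 \<noteq> 0" using h s0 by (auto simp: cyclic_sum_def)
  have "(\<Sum>g\<in>carrier ?G. y g * inverse (fourier_character 1 (\<lambda>_. r) h g))
      = (\<Sum>s<r. y (\<lambda>i\<in>{..<1}. int s) * inverse (fourier_character 1 (\<lambda>_. r) h (\<lambda>i\<in>{..<1}. int s)))"
    by (rule sum.reindex_bij_betw[OF cyclic_sum_one_carrier[OF r], symmetric])
  also have "\<dots> = (\<Sum>s<r. A * cis (2 * pi * of_int (- int s0) * real s / real r))"
  proof (intro sum.cong refl)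
    fix s assume "s \<in> {..<r}"
    have "fourier_character 1 (\<lambda>_. r) h (\<lambda>i\<in>{..<1}. int s) = cis (2 * pi / real r) ^ (s0 * s)"
    proof -
      have "int s0 * int s = int (s0 * s)" by simp
      then show ?thesis by (simp add: fourier_character_def s0(2) del: of_nat_mult)
    qed
    also have "\<dots> = cis (2 * pi * real s0 * real s / real r)"
      by (simp add: Complex.DeMoivre mult_ac)
    finally have "inverse (fourier_character 1 (\<lambda>_. r) h (\<lambda>i\<in>{..<1}. int s))
        = cis (2 * pi * of_int (- int s0) * real s / real r)"
      by simp
    then show "y (\<lambda>i\<in>{..<1}. int s) * inverse (fourier_character 1 (\<lambda>_. r) h (\<lambda>i\<in>{..<1}. int s))
        = A * cis (2 * pi * of_int (- int s0) * real s / real r)"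
      using y \<open>s \<in> {..<r}\<close> by simp
  qed
  also have "\<dots> = A * (if - int s0 = 0 then of_nat r else 0)"
    unfolding sum_distrib_left[symmetric] by (subst sum_character) (use s0(1) in auto)
  finally show ?thesis using \<open>s0 \<noteq> 0\<close> by (simp add: fourier_coefficient_def)
qed

text \<open>Genericity for one cyclic group of order r, a planes and no lines, with every nonzero
  frequency in every S. Then m = a (r - 1) and m' = 0, which gives the dimension bound, and constant
  values make exactly the prescribed coefficients vanish.\<close>

lemma fourier_generic_not_constant:
  fixes f :: "'a::euclidean_space \<Rightarrow> real ^ 'd" and p :: "nat \<Rightarrow> 'd::finite"
  assumes gen: "fourier_generic \<Delta> f" and bij: "bij_betw p {..<2 * a} UNIV" and a: "1 \<le> a" and r: "2 \<le> r"
    and T: "T face_of \<Delta>" "aff_dim T < 2 * int (a * (r - 1)) + int r - 1"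
    and \<tau>: "\<And>g. g < r \<Longrightarrow> \<tau> g face_of \<Delta> \<and> \<tau> g \<subseteq> T \<and> x g \<in> \<tau> g" "disjoint_family_on \<tau> {..<r}"
    and const: "\<And>g. g < r \<Longrightarrow> f (x g) = c"
  shows False
proof -
  let ?G = "cyclic_sum 1 (\<lambda>_. r)"
  let ?S = "\<lambda>_::nat. carrier ?G - {\<one>\<^bsub>?G\<^esub>}"
  let ?U = "\<lambda>i. span {axis (p (2 * i)) 1, axis (p (2 * i + 1)) (1::real)}"
  define X where "X g = x (nat (g 0))" for g :: "nat \<Rightarrow> int"
  have r0: "0 < r" using r by simp
  note carr = cyclic_sum_one_carrier[OF r0]
  have fin: "finite (carrier ?G)" using bij_betw_finite[OF carr] by simp
  have card: "card (carrier ?G) = r" using bij_betw_same_card[OF carr] by simp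
  have "\<one>\<^bsub>?G\<^esub> \<in> carrier ?G" using r0 by (auto simp: cyclic_sum_def carrier_integer_mod_group)
  then have cardS: "card (?S i) = r - 1" for i using card fin by simp
  have carrier_D: "\<exists>s<r. g = (\<lambda>i\<in>{..<1}. int s)" if "g \<in> carrier ?G" for g
    using that unfolding bij_betw_imp_surj_on[OF carr, symmetric] by blast
  have idx: "nat (g 0) < r" if "g \<in> carrier ?G" for g using carrier_D[OF that] by auto
  have idx_inj: "g = g'" if "g \<in> carrier ?G" "g' \<in> carrier ?G" "nat (g 0) = nat (g' 0)" for g g'
    using carrier_D[OF that(1)] carrier_D[OF that(2)] that(3) by auto
  have "disjoint_support T (carrier ?G) X"
    unfolding disjoint_support_def
  proof (intro exI[of _ "\<lambda>g. \<tau> (nat (g 0))"] conjI ballI)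
    fix g assume g: "g \<in> carrier ?G"
    have "T \<subseteq> \<Delta>" using T(1) by (rule face_of_imp_subset)
    then show "\<tau> (nat (g 0)) face_of T"
      using \<tau>(1)[OF idx[OF g]] face_of_subset by blast
    show "X g \<in> \<tau> (nat (g 0))"
      using \<tau>(1)[OF idx[OF g]] by (simp add: X_def)
  next
    show "disjoint_family_on (\<lambda>g. \<tau> (nat (g 0))) (carrier ?G)"
      unfolding disjoint_family_on_def
    proof (intro ballI impI)
      fix g g' assume g: "g \<in> carrier ?G" "g' \<in> carrier ?G" "g \<noteq> g'"
      then have "nat (g 0) \<noteq> nat (g' 0)" using idx_inj by blast
      then show "\<tau> (nat (g 0)) \<inter> \<tau> (nat (g' 0)) = {}"
        using \<tau>(2) idx[OF g(1)] idx[OF g(2)] unfolding disjoint_family_on_def by simp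
    qed
  qed
  moreover have "\<forall>g\<in>carrier ?G. X g \<in> T" using \<tau>(1)[OF idx] unfolding X_def by blast
  moreover have "\<forall>i<a + 0. \<forall>h\<in>?S i. fourier_coefficient 1 (\<lambda>_. r) (\<lambda>g. complex_coordinates p a (f (X g)) i) h = 0"
  proof (intro allI impI ballI)
    fix i h assume "h \<in> ?S i"
    then show "fourier_coefficient 1 (\<lambda>_. r) (\<lambda>g. complex_coordinates p a (f (X g)) i) h = 0"
      by (rule fourier_coefficient_constant[OF _ r0, where A = "complex_coordinates p a c i"])
        (simp add: X_def const)
  qed
  moreover have "\<not> (\<exists>x. (\<forall>g\<in>carrier ?G. x g \<in> T) \<and> disjoint_support T (carrier ?G) x \<and>
      (\<forall>i<a + 0. \<forall>h\<in>?S i. fourier_coefficient 1 (\<lambda>_. r) (\<lambda>g. complex_coordinates p a (f (x g)) i) h = 0))"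
  proof (rule gen[unfolded fourier_generic_def, rule_format, of 1 "\<lambda>_. r" a 0 ?U "\<lambda>_. {}"], intro conjI)
    show "coordinate_decomposition a 0 ?U (\<lambda>_. {})" by (rule coordinate_planes_decomposition[OF bij a])
    show "coordinate_permutation a 0 (complex_coordinates p a)" by (rule complex_coordinates_permutation[OF bij])
    show "\<forall>i<a. complex_coordinates p a ` ?U i = coordinate_axis a 0 i"
      using complex_coordinates_plane[OF bij] by blast
    show "admissible ?G a 0 ?S" by (simp add: admissible_def)
    show "aff_dim T < 2 * int (\<Sum>i<a + 0. card (?S i))
        - int (\<Sum>i\<in>{a..<a + 0}. card (order_two ?G (?S i))) + int (card (carrier ?G)) - 1"
      using T(2) unfolding cardS card by simp
  qed (use r T(1) in auto)
  ultimately show False by blast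
qed

section \<open>Regular polygons with vertices in small disjoint faces\<close>

lemma aff_dim_face_of_simplex:
  fixes C :: "'a::euclidean_space set"
  assumes "\<not> affine_dependent C" "B \<subseteq> C"
  shows "(convex hull B) face_of (convex hull C)" "aff_dim (convex hull B) = int (card B) - 1"
proof -
  show "(convex hull B) face_of (convex hull C)"
    using face_of_convex_hull_affine_independent[OF assms(1)] assms(2) by blast
  have "\<not> affine_dependent B" using assms affine_dependent_subset by blast
  then show "aff_dim (convex hull B) = int (card B) - 1"
    using aff_dim_affine_independent[of B] by (simp add: aff_dim_convex_hull)
qed

lemma disjoint_convex_hulls:
  fixes C :: "'a::euclidean_space set"
  assumes "\<not> affine_dependent C" "B \<subseteq> C" "B' \<subseteq> C" "B \<inter> B' = {}"
  shows "convex hull B \<inter> convex hull B' = {}"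
  using disjoint_affine_hull[OF assms] convex_hull_subset_affine_hull[of B]
    convex_hull_subset_affine_hull[of B'] by blast

theorem theorem6p2:
  fixes r d N :: nat and k :: int
    and \<Delta> :: "'a::euclidean_space set"
    and f :: "'a \<Rightarrow> real ^ 'd"
  assumes "prime r" and "odd r"
    and "d = CARD('d)" and "2 \<le> d" and "even d"
    and "N = (r - 2) * (d + 2) + 2"
    and "int d * (int r - 2) \<le> int r * k" and "int r * k < int d * (int r - 1)"
    and "int N simplex \<Delta>"
    and "continuous_on \<Delta> f"
    and "fourier_generic \<Delta> f"
  shows "\<exists>\<sigma> x. (\<forall>i\<in>{1..r}. \<sigma> i face_of \<Delta> \<and> aff_dim (\<sigma> i) \<le> k \<and> x i \<in> \<sigma> i) \<and>
               disjoint_family_on \<sigma> {1..r} \<and>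
               regular_polygon_vertices r ((\<lambda>i. f (x i)) ` {1..r})"
proof -
  have r: "3 \<le> r" using prime_ge_2_nat[OF assms(1)] assms(2) by (cases "r = 2") auto
  define a where "a = d div 2"
  have d: "d = 2 * a" "1 \<le> a" using assms(4,5) by (auto simp: a_def)
  \<comment> \<open>There are r - 2 frequencies for each of the a complex coordinates and r - 1 for
    weight and distance; then 2n = N.\<close>
  define n where "n = a * (r - 2) + (r - 1)"
  define M where "M = 2 * n + 1"
  obtain s where s: "r = s + 3" using r le_Suc_ex by (metis add.commute)
  have N: "N + 1 = M" unfolding assms(6) M_def n_def d s by (simp add: algebra_simps)
  have n: "1 \<le> n" using r by (simp add: n_def)
  have k: "0 \<le> k"
  proof (rule ccontr)
    assume "\<not> 0 \<le> k"
    then have "int r * k < 0" using r by (simp add: mult_pos_neg)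
    moreover have "0 \<le> int d * (int r - 2)" using r by simp
    ultimately show False using assms(7) by linarith
  qed
  obtain p :: "nat \<Rightarrow> 'd" where p: "bij_betw p {..<2 * a} UNIV"
    using ex_bij_betw_nat_finite[of "UNIV :: 'd set"] assms(3) d(1) by (auto simp: atLeast0LessThan)
  obtain C where C: "\<not> affine_dependent C" "int (card C) = int N + 1" "\<Delta> = convex hull C"
    using assms(9) unfolding simplex_def by blast
  have "finite C" using C(1) by (rule aff_independent_finite)
  have "card C = M" using C(2) N by simp
  then obtain v where v: "bij_betw v {..<M} C"
    using ex_bij_betw_nat_finite[OF \<open>finite C\<close>] by (auto simp: atLeast0LessThan)
  have "compact \<Delta>" unfolding C(3) by (rule finite_imp_compact_convex_hull[OF \<open>finite C\<close>])

  define Sk where "Sk = \<Union>{F. F face_of \<Delta> \<and> aff_dim F \<le> k}"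
  define D where "D x = infdist x Sk" for x
  have "polytope \<Delta>" unfolding C(3) polytope_def using \<open>finite C\<close> by blast
  have "closed Sk"
    unfolding Sk_def
  proof (rule closed_Union)
    show "finite {F. F face_of \<Delta> \<and> aff_dim F \<le> k}"
      by (rule finite_subset[OF _ finite_polytope_faces[OF \<open>polytope \<Delta>\<close>]]) auto
    show "\<forall>F\<in>{F. F face_of \<Delta> \<and> aff_dim F \<le> k}. closed F"
      using face_of_imp_compact \<open>compact \<Delta>\<close> compact_imp_closed C(3) by (metis (no_types, lifting) convex_convex_hull mem_Collect_eq)
  qed
  have face_Sk: "convex hull B \<subseteq> Sk" if "B \<subseteq> C" "int (card B) \<le> k + 1" for B
    using aff_dim_face_of_simplex[OF C(1) that(1)] that(2) unfolding Sk_def C(3) by auto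
  have "v 0 \<in> C" using v by (auto simp: bij_betw_def M_def)
  \<comment> \<open>\<open>infdist\<close> to the empty set is 0, so a nonempty skeleton is required
    for the equivalence below; k \<ge> 0 puts the vertices into it.\<close>
  then have "Sk \<noteq> {}" using face_Sk[of "{v 0}"] k by auto
  have D_0: "D x = 0 \<longleftrightarrow> x \<in> Sk" for x
    unfolding D_def using in_closed_iff_infdist_zero[OF \<open>closed Sk\<close> \<open>Sk \<noteq> {}\<close>] by simp

  define coord where "coord j x = Complex (f x $ p (2 * j)) (f x $ p (2 * j + 1))" for j x
  \<comment> \<open>The number c = j (r - 2) + (l - 1) stands for frequency l of coordinate j; the
    last r - 1 numbers stand for the nonzero frequencies of 1 + \<open>\<i>\<close> D. The frequency
    is \<open>h c\<close>.\<close>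
  define \<phi> where "\<phi> c x = (if c < a * (r - 2) then coord (c div (r - 2)) x else Complex 1 (D x))" for c x
  define h where "h c = (if c < a * (r - 2) then 1 + c mod (r - 2) else 1 + (c - a * (r - 2)))" for c
  have hull_v: "convex hull (v ` {..<M}) = \<Delta>"
    using v C(3) by (simp add: bij_betw_def)
  have cont: "continuous_on (convex hull (v ` {..<2 * n + 1})) (\<phi> c)" for c
  proof -
    have "continuous_on \<Delta> (\<phi> c)"
      unfolding \<phi>_def coord_def D_def Complex_eq using assms(10)
      by (cases "c < a * (r - 2)") (auto intro!: continuous_intros)
    then show ?thesis using hull_v by (simp add: M_def)
  qed
  \<comment> \<open>Primality of r makes all frequencies between 0 and r invertible.\<close>
  have coprime: "coprime (h c) r" if "c < n" for c
  proof -
    have "c mod (r - 2) < r - 2" using r by simp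
    then have "1 + c mod (r - 2) < r" by linarith
    then have "0 < h c" "h c < r" using that r unfolding h_def n_def by auto
    then show ?thesis using assms(1) by (metis coprime_commute nat_dvd_not_less prime_imp_coprime)
  qed
  obtain col t x where col: "\<And>m. col m < r" and t: "\<And>g. 0 \<le> t g" "(\<Sum>g<r. t g) = 1"
    and x: "\<And>g. g < r \<Longrightarrow> t g \<noteq> 0 \<Longrightarrow> x g \<in> convex hull (v ` {m. m < 2 * n + 1 \<and> col m = g})"
    and zero: "\<And>c. c < n \<Longrightarrow> (\<Sum>g<r. cis (2 * pi * real (h c) * real g / real r) * (t g *\<^sub>R \<phi> c (x g))) = 0"
    by (rule weighted_character_sums_vanish[OF prime_ge_2_nat[OF assms(1)] n, of v \<phi> h])
      (use cont coprime in blast)+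

  define V where "V g = v ` {m. m < M \<and> col m = g}" for g
  have V_sub: "V g \<subseteq> C" for g using v by (auto simp: V_def bij_betw_def)
  have V_disj: "V g \<inter> V g' = {}" if "g \<noteq> g'" for g g'
    using v that by (auto simp: V_def bij_betw_def inj_on_def)
  have V_sum: "(\<Sum>g<r. card (V g)) = M"
  proof -
    have "card (V g) = (\<Sum>m | m \<in> {..<M} \<and> col m = g. 1)" for g
    proof -
      have "inj_on v {m. m < M \<and> col m = g}"
        using v by (auto simp: bij_betw_def inj_on_def)
      then show ?thesis unfolding V_def by (simp add: card_image)
    qed
    then have "(\<Sum>g<r. card (V g)) = (\<Sum>m<M. 1)"
      using sum.group[of "{..<M}" "{..<r}" col "\<lambda>_. 1 :: nat"] col by auto
    then show ?thesis by simp
  qed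

  have "(\<Sum>g<r. cis (2 * pi * real l * real g / real r) * (t g *\<^sub>R Complex 1 (D (x g)))) = 0"
    if "0 < l" "l < r" for l
  proof -
    let ?c = "a * (r - 2) + (l - 1)"
    have "?c < n" "h ?c = l" "\<phi> ?c = (\<lambda>x. Complex 1 (D x))"
      using that by (auto simp: n_def h_def \<phi>_def fun_eq_iff)
    then show ?thesis using zero[of ?c] by simp
  qed
  then have const: "of_nat r * (t g *\<^sub>R Complex 1 (D (x g))) = (\<Sum>g<r. t g *\<^sub>R Complex 1 (D (x g)))"
    if "g < r" for g using that by (rule constant_of_character_sums)
  \<comment> \<open>The real part of the constant function gives equal weights; after that, the
    imaginary part gives equal distances.\<close>
  have t_r: "t g = 1 / real r" if "g < r" for g
  proof -
    have "real r * t g = (\<Sum>g<r. t g)" using arg_cong[OF const[OF that], of Re] by (simp add: mult_ac)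
    then show ?thesis using t(2) r by (simp add: field_simps)
  qed
  have x_hull: "x g \<in> convex hull (V g)" if "g < r" for g
    using x[OF that] t_r[OF that] r by (simp add: V_def M_def)
  have D_const: "D (x g) = D (x 0)" if "g < r" for g
  proof -
    have "real r * (t g * D (x g)) = (\<Sum>g<r. t g * D (x g))" if "g < r" for g
      using arg_cong[OF const[OF that], of Im] by (simp add: mult_ac)
    from this[of g] this[of 0] have "real r * (t g * D (x g)) = real r * (t 0 * D (x 0))"
      using that r by simp
    then show ?thesis using t_r[OF that] t_r[of 0] r by simp
  qed
  text \<open>If the common distance to the skeleton were positive, every color class would
    contain at least \<open>k + 2\<close> vertices.\<close>
  have x_Sk: "x g \<in> Sk" if "g < r" for g
  proof (rule ccontr)
    assume "x g \<notin> Sk"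
    then have "D (x g') \<noteq> 0" if "g' < r" for g'
      using D_const[OF that] D_const[OF \<open>g < r\<close>] D_0[of "x g"] by simp
    then have "x g' \<notin> Sk" if "g' < r" for g' using D_0 that by blast
    then have "\<not> int (card (V g')) \<le> k + 1" if "g' < r" for g'
      using face_Sk[OF V_sub, of g'] x_hull[OF that] that by blast
    then have "k + 2 \<le> int (card (V g'))" if "g' < r" for g' using that by force
    then have "(\<Sum>g'<r. k + 2) \<le> (\<Sum>g'<r. int (card (V g')))" by (intro sum_mono) auto
    also have "\<dots> = int M" unfolding V_sum[symmetric] by simp
    finally have "int r * (k + 2) \<le> int M" by simp
    \<comment> \<open>Since r k \<ge> d (r - 2), this is at least one less than r (k + 2).\<close>
    moreover have "int M = int d * (int r - 2) + 2 * int r - 1"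
      unfolding M_def n_def d(1) s by (simp add: algebra_simps)
    ultimately show False using assms(7) by (simp add: algebra_simps)
  qed
  then have "\<exists>F. F face_of \<Delta> \<and> aff_dim F \<le> k \<and> x g \<in> F" if "g < r" for g
    using that by (auto simp: Sk_def)
  then obtain F where F: "\<And>g. g < r \<Longrightarrow> F g face_of \<Delta> \<and> aff_dim (F g) \<le> k \<and> x g \<in> F g"
    by metis
  \<comment> \<open>The faces F g in the skeleton may meet. Intersecting with the hulls of the color
    classes makes them disjoint and keeps them faces of dimension at most k.\<close>
  define \<tau> where "\<tau> g = F g \<inter> convex hull (V g)" for g
  have \<tau>: "\<tau> g face_of \<Delta>" "aff_dim (\<tau> g) \<le> k" "x g \<in> \<tau> g" if "g < r" for g
  proof -
    show "\<tau> g face_of \<Delta>"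
      unfolding \<tau>_def using F[OF that] aff_dim_face_of_simplex(1)[OF C(1) V_sub, of g] C(3)
      by (intro face_of_Int) auto
    show "aff_dim (\<tau> g) \<le> k"
      using F[OF that] aff_dim_subset[of "\<tau> g" "F g"] by (auto simp: \<tau>_def)
    show "x g \<in> \<tau> g" using F[OF that] x_hull[OF that] by (simp add: \<tau>_def)
  qed
  have \<tau>_disj: "\<tau> g \<inter> \<tau> g' = {}" if "g \<noteq> g'" for g g'
    using disjoint_convex_hulls[OF C(1) V_sub V_sub V_disj[OF that]] by (auto simp: \<tau>_def)

  have "(\<Sum>g<r. cis (2 * pi * real l * real g / real r) * coord j (x g)) = 0"
    if "j < a" "0 < l" "l < r - 1" for j l
  proof -
    obtain m where m: "l = Suc m" using \<open>0 < l\<close> by (cases l) auto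
    then have m_less: "m < r - 2" using that(3) by simp
    let ?c = "j * (r - 2) + m"
    have "?c < (j + 1) * (r - 2)" using m_less by simp
    also have "\<dots> \<le> a * (r - 2)" using that(1) by (intro mult_right_mono) auto
    finally have c_less: "?c < a * (r - 2)" .
    then have "?c < n" by (simp add: n_def)
    moreover have "?c div (r - 2) = j" "?c mod (r - 2) = m" using m_less by auto
    ultimately have "?c < n" "h ?c = l" "\<phi> ?c = coord j"
      using c_less m by (auto simp: h_def \<phi>_def fun_eq_iff)
    then have "(\<Sum>g<r. cis (2 * pi * real l * real g / real r) * (t g *\<^sub>R coord j (x g))) = 0"
      using zero[of ?c] by simp
    also have "(\<Sum>g<r. cis (2 * pi * real l * real g / real r) * (t g *\<^sub>R coord j (x g)))
        = (1 / real r) *\<^sub>R (\<Sum>g<r. cis (2 * pi * real l * real g / real r) * coord j (x g))"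
      unfolding scaleR_sum_right by (intro sum.cong refl) (simp add: t_r)
    finally show ?thesis using r by simp
  qed
  note coord_zero = this
  have "\<exists>A B. \<forall>g<r. coord j (x g) = A + B * cis (2 * pi * real g / real r)" if "j < a" for j
    by (rule affine_of_character_sums[OF prime_ge_2_nat[OF assms(1)] coord_zero[OF \<open>j < a\<close>]]) auto
  then obtain A B where AB: "\<And>j g. j < a \<Longrightarrow> g < r \<Longrightarrow>
      coord j (x g) = A j + B j * cis (2 * pi * real g / real r)" by metis

  have "\<exists>j<a. B j \<noteq> 0"
  proof (rule ccontr)
    assume "\<not> ?thesis"
    then have B0: "B j = 0" if "j < a" for j using that by blast
    have eq: "f (x g) = f (x 0)" if "g < r" for g
    proof (rule vec_eq_bij[OF p])
      fix j assume "j < a"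
      then have "coord j (x g) = coord j (x 0)" using AB[of j g] AB[of j 0] B0 that by simp
      then show "f (x g) $ p (2 * j) = f (x 0) $ p (2 * j) \<and> f (x g) $ p (2 * j + 1) = f (x 0) $ p (2 * j + 1)"
        by (simp add: coord_def)
    qed
    have "\<exists>E. E \<subseteq> C \<and> \<tau> g = convex hull E" if "g < r" for g
      using \<tau>(1)[OF that] face_of_convex_hull_affine_independent[OF C(1)] C(3) by auto
    then obtain E where E: "\<And>g. g < r \<Longrightarrow> E g \<subseteq> C \<and> \<tau> g = convex hull (E g)" by metis
    have E_card: "int (card (E g)) \<le> k + 1" if "g < r" for g
      using aff_dim_face_of_simplex(2)[OF C(1), of "E g"] E[OF that] \<tau>(2)[OF that] by simp
    \<comment> \<open>All supports together have at most r (k + 1) vertices, so their face has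
      dimension at most r k + r - 1; the upper bound on k brings this below the threshold d (r - 1)
      + r - 1.\<close>
    let ?W = "\<Union>g<r. E g"
    have W: "?W \<subseteq> C" using E by auto
    have "int (card ?W) \<le> int (\<Sum>g<r. card (E g))"
      unfolding of_nat_le_iff by (rule card_UN_le) simp
    also have "\<dots> \<le> (\<Sum>g<r. k + 1)"
      unfolding of_nat_sum using E_card by (intro sum_mono) auto
    also have "\<dots> = int r * k + int r" by (simp add: algebra_simps)
    finally have dim: "aff_dim (convex hull ?W) \<le> int r * k + int r - 1"
      using aff_dim_face_of_simplex(2)[OF C(1) W] by linarith
    show False
    proof (rule fourier_generic_not_constant[OF assms(11) p d(2) prime_ge_2_nat[OF assms(1)], of "convex hull ?W" \<tau> x "f (x 0)"])
      show "convex hull ?W face_of \<Delta>" unfolding C(3) by (rule aff_dim_face_of_simplex(1)[OF C(1) W])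
      have "2 * int (a * (r - 1)) = int d * (int r - 1)" unfolding d(1) s by (simp add: algebra_simps)
      then show "aff_dim (convex hull ?W) < 2 * int (a * (r - 1)) + int r - 1"
        using dim assms(8) by linarith
      show "\<tau> g face_of \<Delta> \<and> \<tau> g \<subseteq> convex hull ?W \<and> x g \<in> \<tau> g" if "g < r" for g
      proof -
        have "E g \<subseteq> ?W" using that by auto
        then have "convex hull (E g) \<subseteq> convex hull ?W" by (rule hull_mono)
        then show ?thesis using \<tau>[OF that] E[OF that] by simp
      qed
      show "disjoint_family_on \<tau> {..<r}" using \<tau>_disj by (auto simp: disjoint_family_on_def)
    qed (rule eq)
  qed
  then obtain j0 where j0: "j0 < a" "B j0 \<noteq> 0" by blast
  have polygon: "regular_polygon_vertices r ((\<lambda>g. f (x g)) ` {..<r})"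
    by (rule regular_polygon_of_character[where B = B and A = A, OF p r j0]) (use AB in \<open>simp add: coord_def\<close>)
  have image: "(\<lambda>i. f (x (i - 1))) ` {1..r} = (\<lambda>g. f (x g)) ` {..<r}"
  proof -
    have "{..<r} = (\<lambda>i. i - 1) ` {1..r}"
    proof (intro equalityI subsetI)
      fix g assume "g \<in> {..<r}"
      then have "g = Suc g - 1" "Suc g \<in> {1..r}" by auto
      then show "g \<in> (\<lambda>i. i - 1) ` {1..r}" by (rule image_eqI)
    qed auto
    then show ?thesis by (simp add: image_image)
  qed
  show ?thesis
  proof (intro exI[of _ "\<lambda>i. \<tau> (i - 1)"] exI[of _ "\<lambda>i. x (i - 1)"] conjI ballI)
    fix i assume "i \<in> {1..r}"
    then have "i - 1 < r" by auto
    then show "\<tau> (i - 1) face_of \<Delta>" "aff_dim (\<tau> (i - 1)) \<le> k" "x (i - 1) \<in> \<tau> (i - 1)"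
      by (fact \<tau>)+
  next
    show "disjoint_family_on (\<lambda>i. \<tau> (i - 1)) {1..r}"
      unfolding disjoint_family_on_def
    proof (intro ballI impI)
      fix i j assume "i \<in> {1..r}" "j \<in> {1..r}" "i \<noteq> j"
      then have "i - 1 \<noteq> j - 1" by auto
      then show "\<tau> (i - 1) \<inter> \<tau> (j - 1) = {}" by (rule \<tau>_disj)
    qed
    show "regular_polygon_vertices r ((\<lambda>i. f (x (i - 1))) ` {1..r})"
      unfolding image by (rule polygon)
  qed
qed

end
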